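(* Let $\Phi(x)=1+\|x\|_2^2$ on $\mathbb{R}^d$; let $\Xi\in C_b(\mathbb{R}_+)\cap C^1(\mathbb{R}_+)$ be globally Lipschitz with Lipschitz constant $L_{\mathrm{Lip}}(\Xi)$ and with $\kappa\le \Xi(r)\le K$ for all $r\ge 0$, where $0<\kappa<K<\infty$ and $K/\kappa\le 2$; and let the probability density $p_0\in L^\infty(\mathbb{R}^d)\cap L^1(\mathbb{R}^d)$ satisfy $p_0(x)\le c_0\exp\{-b_0\|x\|_2^2\}$ for all $x$, with some $c_0>0$ and some $b_0>\kappa/2$ satisfying also $b_0>\Xi(0)$. Let $\pi$ be the stationary density, i.e. the unique probability density on $\mathbb{R}^d$ solving $\Delta\pi+\operatorname{div}(\nabla\Phi\,\Xi(\pi)\pi)=0$. Then $$\pi(0)e^{-K\|x\|_2^2}\le\pi(x)\le\pi(0)e^{-\kappa\|x\|_2^2},\qquad\forall\,x\in\mathbb{R}^d.$$ In addition, $\pi$ satisfies the Log-Sobolev and Poincar\'e inequalities with constants $C_{\mathrm{LSI}}$ resp. $C_{\mathrm{Poin}}$ such that $$C_{\mathrm{Poin}}\le C_{\mathrm{LSI}}\le\frac{1}{2\Xi(0)}\exp\left\{\frac{L_{\mathrm{Lip}}(\Xi)\,\pi(0)}{\kappa}\right\}.$$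
   Context: $d\ge1$, $\mathbb{R}_+=[0,\infty)$, $\|\cdot\|_2$ is the Euclidean norm; $\nabla\Phi(x)=2x$; the equation for $\pi$ is understood weakly. The stationary density exists, is unique, and is given by $\pi(x)=g^{-1}(\mu-\Phi(x))$, where $g(r)=\int_1^r\frac{ds}{s\,\Xi(s)}$ for $r>0$ and $\mu\in\mathbb{R}$ is the unique number for which $\int_{\mathbb{R}^d}g^{-1}(\mu-\Phi(x))\,dx=1$. Conventions: $\pi$ satisfies the Poincar\'e inequality with constant $C_{\mathrm{Poin}}$ if $\int f^2\pi\,dx-\big(\int f\pi\,dx\big)^2\le C_{\mathrm{Poin}}\int\|\nabla f\|_2^2\,\pi\,dx$, and the Log-Sobolev inequality with constant $C_{\mathrm{LSI}}$ if $\int f^2\log f^2\,\pi\,dx-\int f^2\pi\,dx\,\log\int f^2\pi\,dx\le 2C_{\mathrm{LSI}}\int\|\nabla f\|_2^2\,\pi\,dx$, for all sufficiently regular $f$ (so the density proportional to $e^{-\Xi(0)\|x\|_2^2}$ has both constants equal to $1/(2\Xi(0))$). *)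

theory Defs
  imports "HOL-Analysis.Analysis"
begin

definition grad :: "('a::euclidean_space \<Rightarrow> real) \<Rightarrow> 'a \<Rightarrow> 'a" where
  "grad f x = (\<Sum>b\<in>Basis. frechet_derivative f (at x) b *\<^sub>R b)"

definition divergence :: "('a::euclidean_space \<Rightarrow> 'a) \<Rightarrow> 'a \<Rightarrow> real" where
  "divergence F x = (\<Sum>b\<in>Basis. frechet_derivative F (at x) b \<bullet> b)"

definition laplacian :: "('a::euclidean_space \<Rightarrow> real) \<Rightarrow> 'a \<Rightarrow> real" where
  "laplacian f = divergence (grad f)"

primrec C_class :: "nat \<Rightarrow> ('a::euclidean_space \<Rightarrow> real) \<Rightarrow> bool" where
  "C_class 0 f \<longleftrightarrow> continuous_on UNIV f"
| "C_class (Suc k) f \<longleftrightarrow>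
     f differentiable_on UNIV \<and> (\<forall>b\<in>Basis. C_class k (\<lambda>x. grad f x \<bullet> b))"

definition test_function :: "('a::euclidean_space \<Rightarrow> real) \<Rightarrow> bool" where
  "test_function \<phi> \<longleftrightarrow> (\<forall>k. C_class k \<phi>) \<and> compact (closure {x. \<phi> x \<noteq> 0})"

text \<open>Continuously differentiable on the half-line, with the one-sided derivative at 0.\<close>

definition C1_halfline :: "(real \<Rightarrow> real) \<Rightarrow> bool" where
  "C1_halfline \<Xi> \<longleftrightarrow>
     (\<exists>\<Xi>'. (\<forall>r\<ge>0. (\<Xi> has_real_derivative \<Xi>' r) (at r within {0..})) \<and> continuous_on {0..} \<Xi>')"

definition Phi :: "'a::euclidean_space \<Rightarrow> real" where
  "Phi x = 1 + (norm x)\<^sup>2"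

definition prob_density :: "('a::euclidean_space \<Rightarrow> real) \<Rightarrow> bool" where
  "prob_density \<rho> \<longleftrightarrow> (\<forall>x. 0 \<le> \<rho> x) \<and> has_bochner_integral lborel \<rho> 1"

text \<open>
  Probability densities solving \<open>\<Delta>\<rho> + div (\<nabla>\<Phi> \<Xi>(\<rho>) \<rho>) = 0\<close> in the sense of distributions.
  The integrand below is integrable whenever \<open>\<Xi>\<close> is continuous and bounded on the half-line.
\<close>

definition stationary_density :: "(real \<Rightarrow> real) \<Rightarrow> ('a::euclidean_space \<Rightarrow> real) \<Rightarrow> bool" where
  "stationary_density \<Xi> \<rho> \<longleftrightarrow> prob_density \<rho> \<and>
     (\<forall>\<phi>. test_function \<phi> \<longrightarrow>
        (\<integral>x. \<rho> x * laplacian \<phi> x - \<Xi> (\<rho> x) * \<rho> x * (grad Phi x \<bullet> grad \<phi> x) \<partial>lborel) = 0)"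

text \<open>
  The functional inequalities are required for all \<open>C\<^sup>1\<close> functions which, together with their
  gradient, are square integrable with respect to the density.
\<close>

definition weighted_C1 :: "('a::euclidean_space \<Rightarrow> real) \<Rightarrow> ('a \<Rightarrow> real) \<Rightarrow> bool" where
  "weighted_C1 \<rho> f \<longleftrightarrow> C_class 1 f \<and>
     integrable lborel (\<lambda>x. (f x)\<^sup>2 * \<rho> x) \<and>
     integrable lborel (\<lambda>x. (norm (grad f x))\<^sup>2 * \<rho> x)"

definition poincare_ineq :: "('a::euclidean_space \<Rightarrow> real) \<Rightarrow> real \<Rightarrow> bool" where
  "poincare_ineq \<rho> C \<longleftrightarrow> (\<forall>f. weighted_C1 \<rho> f \<longrightarrow>
     (\<integral>x. (f x)\<^sup>2 * \<rho> x \<partial>lborel) - (\<integral>x. f x * \<rho> x \<partial>lborel)\<^sup>2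
       \<le> C * (\<integral>x. (norm (grad f x))\<^sup>2 * \<rho> x \<partial>lborel))"

text \<open>
  Finiteness of the entropy is part of the Log-Sobolev inequality (the Bochner integral of a
  non-integrable function would be 0).  The convention \<open>0 log 0 = 0\<close> holds automatically.
\<close>

definition log_sobolev_ineq :: "('a::euclidean_space \<Rightarrow> real) \<Rightarrow> real \<Rightarrow> bool" where
  "log_sobolev_ineq \<rho> C \<longleftrightarrow> (\<forall>f. weighted_C1 \<rho> f \<longrightarrow>
     integrable lborel (\<lambda>x. (f x)\<^sup>2 * ln ((f x)\<^sup>2) * \<rho> x) \<and>
     (\<integral>x. (f x)\<^sup>2 * ln ((f x)\<^sup>2) * \<rho> x \<partial>lborel)
         - (\<integral>x. (f x)\<^sup>2 * \<rho> x \<partial>lborel) * ln (\<integral>x. (f x)\<^sup>2 * \<rho> x \<partial>lborel)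
       \<le> 2 * C * (\<integral>x. (norm (grad f x))\<^sup>2 * \<rho> x \<partial>lborel))"

end

theory Submission
  imports Defs "HOL-Probability.Distributions"
begin

text \<open>
  The stationary density is explicit.  If \<open>v\<close> solves the scalar equation \<open>v' = \<Xi> (exp v)\<close>, then
  \<open>\<rho> x = exp (v (m - (norm x)\<^sup>2))\<close> satisfies \<open>\<nabla>\<rho> = - \<Xi>(\<rho>) \<rho> \<nabla>\<Phi>\<close>: its flux vanishes pointwise, and hence
  also weakly.  Shifting \<open>m\<close> adjusts the total mass to 1 (\<open>radial_stationary_density\<close>).  By uniqueness
  and continuity \<open>\<pi>\<close> is this density, and the pointwise bounds are \<open>\<kappa> \<le> v' \<le> K\<close> integrated.

  For the functional inequalities, write \<open>a = \<Xi> 0\<close> and compare \<open>\<pi>\<close> with the Gaussian weight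
  \<open>\<gamma> x = exp (- a * (norm x)\<^sup>2)\<close>.  As a function of \<open>s = (norm x)\<^sup>2\<close>, the logarithm of \<open>\<pi> / \<gamma>\<close> has derivative
  \<open>\<Xi> 0 - \<Xi> (\<pi> x)\<close>, which is at most \<open>L * \<pi> x \<le> L * \<pi> 0 * exp (- \<kappa> * s)\<close> in absolute value.  Integrating
  over the half-line, the oscillation of the logarithm is at most \<open>L * \<pi> 0 / \<kappa>\<close>
  (\<open>log_ratio_oscillation\<close>).  The Gaussian weight satisfies the Log-Sobolev inequality with constant
  \<open>1 / (2 * a)\<close>, and a density ratio between \<open>c\<^sub>1\<close> and \<open>c\<^sub>2\<close> costs at most the factor \<open>c\<^sub>2 / c\<^sub>1\<close>
  (\<open>holley_stroock_perturbation\<close>); here this factor is \<open>exp (L * \<pi> 0 / \<kappa>)\<close>.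

  The Gaussian inequality is proved on cubes, where every continuous function is integrable.  In one
  dimension (\<open>gaussian_log_sobolev_interval\<close>) it comes from monotone transport: if the increasing map
  \<open>T x = x + \<theta> x\<close> of an interval onto itself pushes the measure with density \<open>F w\<close> to the one with
  density \<open>w\<close>, \<open>w x = exp (- a * x\<^sup>2)\<close>, the change of variables formula gives
  \<open>ln F = ln (1 + \<theta>') - 2 a x \<theta> - a \<theta>\<^sup>2 \<le> \<theta>' - 2 a x \<theta> - a \<theta>\<^sup>2\<close>.  Integrating against \<open>F w\<close> and by
  parts, with \<open>\<theta> = 0\<close> at the end points, leaves \<open>\<integral> (- \<theta> F' - a \<theta>\<^sup>2 F) w\<close>, and completing the square
  bounds this by \<open>1 / (4 a) \<integral> F'\<^sup>2 / F w\<close>.  In higher dimension the entropy is split by averaging out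
  one coordinate after the other (\<open>entropy_telescope\<close>).

  On a cube the Poincare inequality follows from the Log-Sobolev inequality for \<open>1 + \<epsilon> g\<close> as \<open>\<epsilon>\<close> tends
  to 0, with the same constant (\<open>poincare_of_log_sobolev\<close>).  Both inequalities survive the exhaustion
  of the space by cubes (\<open>log_sobolev_ineq_of_cubes\<close>, \<open>poincare_ineq_of_cubes\<close>).
\<close>

section \<open>Gradients, test functions and integrals over boxes\<close>

lemma frechet_derivative_eq_grad:
  fixes f :: "'a::euclidean_space \<Rightarrow> real"
  assumes "f differentiable (at x)"
  shows "frechet_derivative f (at x) h = grad f x \<bullet> h"
proof -
  interpret linear "frechet_derivative f (at x)"
    using assms by (rule linear_frechet_derivative)
  have "frechet_derivative f (at x) h = frechet_derivative f (at x) (\<Sum>b\<in>Basis. (h \<bullet> b) *\<^sub>R b)"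
    by (simp add: euclidean_representation)
  also have "\<dots> = grad f x \<bullet> h"
    by (simp add: sum scale grad_def inner_sum_left inner_sum_right inner_commute mult.commute)
  finally show ?thesis .
qed

lemma has_derivative_grad:
  fixes f :: "'a::euclidean_space \<Rightarrow> real"
  assumes "f differentiable (at x)"
  shows "(f has_derivative (\<lambda>h. grad f x \<bullet> h)) (at x)"
  using assms frechet_derivative_works frechet_derivative_eq_grad[OF assms]
  by (metis (no_types, lifting) ext)

lemma grad_eqI:
  fixes f :: "'a::euclidean_space \<Rightarrow> real"
  assumes "(f has_derivative (\<lambda>h. v \<bullet> h)) (at x)"
  shows "grad f x = v"
  using assms by (simp add: grad_def frechet_derivative_at[OF assms, symmetric] euclidean_representation)

lemma grad_Phi: "grad Phi x = 2 *\<^sub>R x"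
proof (rule grad_eqI)
  have "((\<lambda>x. 1 + x \<bullet> x) has_derivative (\<lambda>h. 2 *\<^sub>R x \<bullet> h)) (at x)"
    by (auto intro!: derivative_eq_intros simp: inner_commute)
  then show "(Phi has_derivative (\<lambda>h. 2 *\<^sub>R x \<bullet> h)) (at x)"
    unfolding Phi_def[abs_def] power2_norm_eq_inner .
qed

lemma C_class_1D:
  assumes "C_class 1 f"
  shows "f differentiable (at x)" "continuous_on UNIV f" "continuous_on UNIV (grad f)"
proof -
  have d: "f differentiable_on UNIV" and c: "\<forall>b\<in>Basis. continuous_on UNIV (\<lambda>x. grad f x \<bullet> b)"
    using assms by (auto simp: One_nat_def)
  show "f differentiable (at x)" using d by (auto simp: differentiable_on_def)
  show "continuous_on UNIV f" using d by (rule differentiable_imp_continuous_on)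
  show "continuous_on UNIV (grad f)"
    using c by (subst continuous_on_componentwise) auto
qed

lemma line_derivative_grad:
  fixes f :: "'a::euclidean_space \<Rightarrow> real"
  assumes "f differentiable (at (x + t *\<^sub>R b))"
  shows "((\<lambda>t. f (x + t *\<^sub>R b)) has_real_derivative grad f (x + t *\<^sub>R b) \<bullet> b) (at t)"
proof -
  have "((\<lambda>t. x + t *\<^sub>R b) has_derivative (\<lambda>t. t *\<^sub>R b)) (at t)"
    by (auto intro!: derivative_eq_intros)
  from has_derivative_compose[OF this has_derivative_grad[OF assms]]
  have "((\<lambda>t. f (x + t *\<^sub>R b)) has_derivative (*) (grad f (x + t *\<^sub>R b) \<bullet> b)) (at t)"
    by (rule has_derivative_eq_rhs) (simp add: fun_eq_iff)
  then show ?thesis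
    by (simp add: has_field_derivative_def)
qed

text \<open>
  The complement of the closed support is open, so \<open>f\<close> agrees with 0 near each of its points.
\<close>

lemma outside_support_zero:
  fixes f :: "'a::euclidean_space \<Rightarrow> real"
  assumes "x \<notin> closure {x. f x \<noteq> 0}"
  shows "f x = 0" "grad f x = 0"
proof -
  show "f x = 0" using assms closure_subset[of "{x. f x \<noteq> 0}"] by auto
  have "((\<lambda>x. 0::real) has_derivative (\<lambda>h. (0::'a) \<bullet> h)) (at x)" by simp
  then have "(f has_derivative (\<lambda>h. 0 \<bullet> h)) (at x)"
  proof (rule has_derivative_transform_within_open)
    show "open (- closure {x. f x \<noteq> 0})" by (rule open_Compl[OF closed_closure])
    show "0 = f y" if "y \<in> - closure {x. f x \<noteq> 0}" for y
      using that closure_subset[of "{x. f x \<noteq> 0}"] by auto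
  qed (use assms in simp)
  then show "grad f x = 0" by (rule grad_eqI)
qed

text \<open>
  Expresses the Laplacian by iterated scalar gradients, to which the smoothness class of a test
  function applies directly.
\<close>

lemma laplacian_eq_sum:
  fixes \<phi> :: "'a::euclidean_space \<Rightarrow> real"
  assumes "\<And>b. b \<in> Basis \<Longrightarrow> (\<lambda>x. grad \<phi> x \<bullet> b) differentiable (at x)"
  shows "laplacian \<phi> x = (\<Sum>b\<in>Basis. grad (\<lambda>x. grad \<phi> x \<bullet> b) x \<bullet> b)"
proof -
  have d: "grad \<phi> differentiable (at x)"
    using assms by (subst differentiable_componentwise_within) auto
  have "frechet_derivative (grad \<phi>) (at x) b \<bullet> b = grad (\<lambda>x. grad \<phi> x \<bullet> b) x \<bullet> b" if b: "b \<in> Basis" for b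
  proof -
    have "((\<lambda>x. grad \<phi> x \<bullet> b) has_derivative (\<lambda>h. frechet_derivative (grad \<phi>) (at x) h \<bullet> b)) (at x)"
      using d by (intro has_derivative_inner_left) (simp add: frechet_derivative_works)
    from frechet_derivative_at[OF this] show ?thesis
      using frechet_derivative_eq_grad[OF assms[OF b], of b] by metis
  qed
  then show ?thesis by (simp add: laplacian_def divergence_def)
qed

lemma lborel_integral_translation:
  fixes g :: "'a::euclidean_space \<Rightarrow> real"
  assumes "g \<in> borel_measurable borel"
  shows "(\<integral>x. g (c + x) \<partial>lborel) = (\<integral>x. g x \<partial>lborel)"
  using integral_distr[of "(+) c" lborel borel g] assms by (simp add: lborel_distr_plus)

lemma lborel_integrable_translation:
  fixes g :: "'a::euclidean_space \<Rightarrow> real"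
  assumes "integrable lborel g"
  shows "integrable lborel (\<lambda>x. g (c + x))"
  using integrable_distr[of "(+) c" lborel borel g] assms by (simp add: lborel_distr_plus)

lemma integrable_continuous_compact_support:
  fixes g :: "'a::euclidean_space \<Rightarrow> real"
  assumes "continuous_on UNIV g" "compact S" "\<And>x. x \<notin> S \<Longrightarrow> g x = 0"
  shows "integrable lborel g"
proof -
  have "integrable lborel (\<lambda>x. indicator S x *\<^sub>R g x)"
    using assms by (intro borel_integrable_compact) (auto intro: continuous_on_subset)
  moreover have "(\<lambda>x. indicator S x *\<^sub>R g x) = g"
    using assms(3) by (auto simp: indicator_def fun_eq_iff)
  ultimately show ?thesis by simp
qed

lemma integral_indicator_cbox:
  fixes f :: "'a::euclidean_space \<Rightarrow> real"
  assumes "continuous_on (cbox l u) f"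
  shows "(\<integral>x. indicator (cbox l u) x * f x \<partial>lborel) = integral (cbox l u) f"
    "integrable lborel (\<lambda>x. indicator (cbox l u) x * f x)"
proof -
  have i: "integrable lborel (\<lambda>x. indicator (cbox l u) x *\<^sub>R f x)"
    using assms by (intro borel_integrable_compact compact_cbox)
  then show "integrable lborel (\<lambda>x. indicator (cbox l u) x * f x)" by simp
  show "(\<integral>x. indicator (cbox l u) x * f x \<partial>lborel) = integral (cbox l u) f"
    using set_borel_integral_eq_integral(2)[of "cbox l u" f] i
    by (simp add: set_integrable_def set_lebesgue_integral_def)
qed

lemma integral_cbox_pos:
  fixes g :: "'a::euclidean_space \<Rightarrow> real"
  assumes "box l u \<noteq> {}" "continuous_on (cbox l u) g" "\<And>x. 0 < g x"
  shows "0 < integral (cbox l u) g"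
proof -
  have "0 \<le> integral (cbox l u) g"
    using assms by (intro integral_nonneg integrable_continuous) (auto intro: less_imp_le)
  moreover have "integral (cbox l u) g \<noteq> 0"
  proof
    assume "integral (cbox l u) g = 0"
    then have "\<forall>x\<in>cbox l u. g x = 0"
      using integral_cbox_eq_0_iff[of l u g] assms by (simp add: less_imp_le)
    moreover have "cbox l u \<noteq> {}" using assms(1) box_subset_cbox[of l u] by auto
    ultimately obtain x where "g x = 0" by auto
    then show False using assms(3)[of x] by simp
  qed
  ultimately show ?thesis by simp
qed

lemma integral_Icc_pos:
  fixes g :: "real \<Rightarrow> real"
  assumes "l < r" "continuous_on {l..r} g" "\<And>x. 0 < g x"
  shows "0 < integral {l..r} g"
  using integral_cbox_pos[of l r g] assms by simp

text \<open>
  The set where the two functions agree is closed and of full measure, and every nonempty open set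
  has positive measure.
\<close>

lemma AE_lborel_eq_continuous_imp_eq:
  fixes f g :: "'a::euclidean_space \<Rightarrow> real"
  assumes "AE x in lborel. f x = g x" "continuous_on UNIV f" "continuous_on UNIV g"
  shows "f x = g x"
proof -
  have "closed {x. f x = g x}" using assms by (intro closed_Collect_eq) auto
  moreover have "AE x in lebesgue. x \<in> {x. f x = g x}"
    using assms(1) by (auto intro: AE_completion)
  ultimately have "x \<in> {x. f x = g x}" by (rule mem_closed_if_AE_lebesgue)
  then show ?thesis by simp
qed

section \<open>The stationary density\<close>

lemma derivative_bounds_imp_increment_bounds:
  fixes u :: "real \<Rightarrow> real"
  assumes der: "\<And>t. (u has_real_derivative u' t) (at t)"
    and b: "\<And>t. k \<le> u' t" "\<And>t. u' t \<le> K"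
    and "s \<le> t"
  shows "k * (t - s) \<le> u t - u s" "u t - u s \<le> K * (t - s)"
proof -
  have "k * (t - s) \<le> u t - u s \<and> u t - u s \<le> K * (t - s)"
  proof (cases "s = t")
    case False
    then obtain z where "u t - u s = (t - s) * u' z"
      using MVT2[of s t u u'] der \<open>s \<le> t\<close> by auto
    then show ?thesis
      using b[of z] \<open>s \<le> t\<close> by (auto simp: mult.commute[of "t - s"] intro!: mult_right_mono)
  qed simp
  then show "k * (t - s) \<le> u t - u s" "u t - u s \<le> K * (t - s)" by auto
qed

text \<open>
  Its main use is surjectivity: of an antiderivative whose inverse is the profile of the stationary
  density, and of the logarithm of the total mass as a function of the shift.  Linear growth from
  below makes the intermediate value theorem applicable.
\<close>

lemma bilipschitz_increasing_homeo:
  fixes u :: "real \<Rightarrow> real"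
  assumes lo: "\<And>s t. s \<le> t \<Longrightarrow> k * (t - s) \<le> u t - u s"
    and up: "\<And>s t. s \<le> t \<Longrightarrow> u t - u s \<le> K * (t - s)"
    and k: "0 < k"
  shows "continuous_on UNIV u" "bij u"
proof -
  have K: "0 < K"
    using lo[of 0 1] up[of 0 1] k by simp
  have "K-lipschitz_on UNIV u"
  proof (rule lipschitz_onI)
    fix x y :: real
    show "dist (u x) (u y) \<le> K * dist x y"
    proof (cases "x \<le> y")
      case True
      moreover from True have "0 \<le> k * (y - x)" using k by simp
      ultimately show ?thesis
        using lo[OF True] up[OF True] by (simp add: dist_real_def abs_if)
    next
      case False
      moreover from False have "0 \<le> k * (x - y)" using k by simp
      ultimately show ?thesis
        using lo[of y x] up[of y x] by (simp add: dist_real_def abs_if)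
    qed
  qed (use K in simp)
  then show c: "continuous_on UNIV u"
    by (rule lipschitz_on_continuous_on)
  have "inj u"
  proof (rule linorder_injI)
    fix x y :: real assume "x < y"
    then have "0 < k * (y - x)" using k by simp
    then show "u x \<noteq> u y" using lo[of x y] \<open>x < y\<close> by simp
  qed
  moreover have "surj u"
    unfolding surj_def
  proof
    fix y
    define b where "b = (\<bar>y - u 0\<bar>) / k"
    have b: "0 \<le> b" "k * b = \<bar>y - u 0\<bar>" using k by (auto simp: b_def)
    have "u (-b) \<le> y" "y \<le> u b"
      using lo[of "-b" 0] lo[of 0 b] b by (auto simp: algebra_simps)
    then have "\<exists>x\<ge>-b. x \<le> b \<and> u x = y"
      using b c by (intro IVT') (auto intro: continuous_on_subset)
    then show "\<exists>x. y = u x" by blast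
  qed
  ultimately show "bij u" by (simp add: bij_def)
qed

text \<open>
  The equation \<open>v' = \<Xi> (exp v)\<close> is autonomous: its solution is the inverse of an antiderivative \<open>T\<close> of
  \<open>1 / \<Xi> (exp w)\<close>.  The bounds on \<open>\<Xi>\<close> make \<open>T\<close> bi-Lipschitz, so that the inverse is defined on the
  whole line.
\<close>

lemma log_profile_exists:
  fixes \<Xi> :: "real \<Rightarrow> real"
  assumes cont: "continuous_on {0..} \<Xi>"
    and bounds: "\<And>r. 0 \<le> r \<Longrightarrow> \<kappa> \<le> \<Xi> r \<and> \<Xi> r \<le> K"
    and \<kappa>: "0 < \<kappa>"
  obtains v where "\<And>t. (v has_real_derivative \<Xi> (exp (v t))) (at t)"
proof -
  define q where "q = (\<lambda>w. 1 / \<Xi> (exp w))"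
  have pos: "0 < \<Xi> (exp w)" for w using bounds[of "exp w"] \<kappa> by simp
  have "continuous_on UNIV (\<lambda>w. \<Xi> (exp w))"
    by (rule continuous_on_compose2[OF cont]) (auto intro: continuous_intros)
  then have cq: "continuous_on UNIV q"
    unfolding q_def using pos by (intro continuous_on_divide) (auto simp: less_imp_neq[symmetric])
  have "\<exists>F. \<forall>x. - \<infinity> < ereal x \<longrightarrow> ereal x < \<infinity> \<longrightarrow> (F has_vector_derivative q x) (at x)"
    using cq by (intro einterval_antiderivative) (auto simp: continuous_on_eq_continuous_at)
  then obtain T where T: "\<And>x. (T has_real_derivative q x) (at x)"
    by (auto simp: has_real_derivative_iff_has_vector_derivative)
  have qb: "1 / K \<le> q w" "q w \<le> 1 / \<kappa>" for w
    using bounds[of "exp w"] \<kappa> pos[of w] unfolding q_def by (auto intro!: divide_left_mono)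
  have K: "0 < K" using bounds[of 0] \<kappa> by simp
  note inc = derivative_bounds_imp_increment_bounds[of T q "1/K" "1/\<kappa>", OF T qb]
  have bT: "bij T"
    using bilipschitz_increasing_homeo(2)[of "1/K" T "1/\<kappa>"] inc K by auto
  define v where "v = inv T"
  have Tv: "T (v t) = t" for t using bT by (simp add: v_def bij_is_surj surj_f_inv_f)
  \<comment> \<open>Applied to \<open>v\<close> itself, these increments give the continuity needed to differentiate the inverse.\<close>
  have vinc: "s \<le> t \<Longrightarrow> \<kappa> * (t - s) \<le> v t - v s \<and> v t - v s \<le> K * (t - s)" for s t
  proof -
    assume st: "s \<le> t"
    have vm: "v s \<le> v t"
    proof (rule ccontr)
      assume "\<not> ?thesis"
      then have "v t < v s" by simp
      then have "0 < 1/K * (v s - v t)" using K by simp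
      with inc(1)[of "v t" "v s"] \<open>v t < v s\<close> st show False by (simp add: Tv)
    qed
    show ?thesis
      using inc[OF vm] K \<kappa> by (simp add: Tv field_simps)
  qed
  have cv: "continuous_on UNIV v"
    using bilipschitz_increasing_homeo(1)[of \<kappa> v K] vinc \<kappa> by auto
  have "(v has_real_derivative \<Xi> (exp (v t))) (at t)" for t
  proof -
    have "(v has_real_derivative inverse (q (v t))) (at t)"
    proof (rule DERIV_inverse_function[where f = T and a = "t - 1" and b = "t + 1"])
      show "DERIV T (v t) :> q (v t)" by (rule T)
      show "q (v t) \<noteq> 0" using pos[of "v t"] by (simp add: q_def)
      show "isCont v t" using cv by (simp add: continuous_on_eq_continuous_at)
    qed (auto simp: Tv)
    then show ?thesis by (simp add: q_def)
  qed
  then show thesis using that by blast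
qed

text \<open>
  The weight is a product of one-dimensional Gaussian factors.
\<close>

lemma integrable_gaussian_weight:
  fixes \<kappa> :: real
  assumes "0 < \<kappa>"
  shows "integrable lborel (\<lambda>x::'a::euclidean_space. exp (- \<kappa> * (norm x)\<^sup>2))"
proof (rule integrableI_nonneg)
  define \<sigma> where "\<sigma> = sqrt (1 / (2 * \<kappa>))"
  have \<sigma>: "0 < \<sigma>" "\<sigma>\<^sup>2 = 1 / (2 * \<kappa>)" using assms by (auto simp: \<sigma>_def)
  have "integrable lborel (normal_density 0 \<sigma>)"
    using \<sigma> by (rule_tac integrable_normal_density)
  then have "integrable lborel (\<lambda>x. sqrt (2 * pi * \<sigma>\<^sup>2) * normal_density 0 \<sigma> x)"
    by simp
  moreover have "sqrt (2 * pi * \<sigma>\<^sup>2) * normal_density 0 \<sigma> x = exp (- \<kappa> * x\<^sup>2)" for x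
    using \<sigma> assms by (simp add: normal_density_def)
  ultimately have int1: "integrable lborel (\<lambda>x::real. exp (- \<kappa> * x\<^sup>2))"
    by simp
  have "(\<integral>\<^sup>+(x::'a). ennreal (exp (- \<kappa> * (norm x)\<^sup>2)) \<partial>lborel)
      = (\<integral>\<^sup>+(x::'a). (\<Prod>b\<in>Basis. ennreal (exp (- \<kappa> * (x \<bullet> b)\<^sup>2))) \<partial>lborel)"
  proof (rule nn_integral_cong)
    fix x :: 'a
    have "(norm x)\<^sup>2 = (\<Sum>b\<in>Basis. (x \<bullet> b)\<^sup>2)"
      unfolding power2_norm_eq_inner by (subst euclidean_inner) (simp add: power2_eq_square)
    then show "ennreal (exp (- \<kappa> * (norm x)\<^sup>2)) = (\<Prod>b\<in>Basis. ennreal (exp (- \<kappa> * (x \<bullet> b)\<^sup>2)))"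
      by (simp add: prod_ennreal exp_sum[symmetric] sum_distrib_left sum_negf)
  qed
  also have "\<dots> = (\<Prod>b\<in>(Basis::'a set). \<integral>\<^sup>+x. ennreal (exp (- \<kappa> * x\<^sup>2)) \<partial>lborel)"
    by (rule nn_integral_lborel_prod) auto
  also have "\<dots> < \<infinity>"
    using int1 by (simp add: nn_integral_eq_integral ennreal_power)
  finally show "(\<integral>\<^sup>+(x::'a). ennreal (exp (- \<kappa> * (norm x)\<^sup>2)) \<partial>lborel) < \<infinity>" .
qed auto

text \<open>
  Integration by parts without boundary terms.  By translation invariance every difference quotient
  of \<open>g\<close> in direction \<open>b\<close> has integral 0; the quotients are uniformly bounded with a common compact
  support, so dominated convergence applies.
\<close>

lemma integral_directional_derivative_eq_0:
  fixes g g' :: "'a::euclidean_space \<Rightarrow> real"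
  assumes der: "\<And>x. ((\<lambda>t. g (x + t *\<^sub>R b)) has_real_derivative g' x) (at 0)"
    and cg: "continuous_on UNIV g" and cg': "continuous_on UNIV g'"
    and S: "compact S" "\<And>x. x \<notin> S \<Longrightarrow> g x = 0" "\<And>x. x \<notin> S \<Longrightarrow> g' x = 0"
  shows "(\<integral>x. g' x \<partial>lborel) = 0"
proof -
  define q where "q = (\<lambda>(n::nat) x. (g (x + (1 / Suc n) *\<^sub>R b) - g x) / (1 / Suc n))"
  \<comment> \<open>\<open>S\<close> swept along \<open>- b\<close>, outside of which all difference quotients vanish\<close>
  define S' where "S' = (\<lambda>(x, t). x + t *\<^sub>R b) ` (S \<times> {-1..0::real})"
  have S': "compact S'" unfolding S'_def split_beta
    using S(1) by (intro compact_continuous_image compact_Times) (auto intro!: continuous_intros)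
  have der': "((\<lambda>t. g (x + t *\<^sub>R b)) has_real_derivative g' (x + s *\<^sub>R b)) (at s)" for x s
    using der[of "x + s *\<^sub>R b"] DERIV_shift[of "\<lambda>t. g (x + t *\<^sub>R b)" "g' (x + s *\<^sub>R b)" 0 s]
    by (simp add: algebra_simps)
  have "bounded (g' ` S)" using cg' S(1)
    by (intro compact_imp_bounded compact_continuous_image) (auto intro: continuous_on_subset)
  then obtain M where M: "\<And>x. x \<in> S \<Longrightarrow> \<bar>g' x\<bar> \<le> M" "0 \<le> M"
    unfolding bounded_pos by (auto intro: less_imp_le)
  have M': "\<bar>g' x\<bar> \<le> M" for x using M S(3)[of x] by (cases "x \<in> S") auto
  have qmvt: "\<exists>z. 0 < z \<and> z < 1 / Suc n \<and> q n x = g' (x + z *\<^sub>R b)" for n x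
  proof -
    obtain z where "0 < z" "z < 1 / Suc n"
       "g (x + (1 / Suc n) *\<^sub>R b) - g (x + 0 *\<^sub>R b) = (1 / Suc n - 0) * g' (x + z *\<^sub>R b)"
      using MVT2[of 0 "1 / Suc n" "\<lambda>t. g (x + t *\<^sub>R b)" "\<lambda>t. g' (x + t *\<^sub>R b)"] der' by auto
    then show ?thesis by (intro exI[of _ z]) (auto simp: q_def field_simps)
  qed
  have qb: "\<bar>q n x\<bar> \<le> M * indicator S' x" for n x
  proof (cases "q n x = 0")
    case False
    obtain z where z: "0 < z" "z < 1 / Suc n" "q n x = g' (x + z *\<^sub>R b)" using qmvt by blast
    have "1 / real (Suc n) \<le> 1" by (simp add: field_simps)
    then have "z < 1" using z(2) by linarith
    moreover have "x + z *\<^sub>R b \<in> S" using False z S(3) by auto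
    ultimately have "x \<in> S'" using z unfolding S'_def
      by (intro image_eqI[of _ _ "(x + z *\<^sub>R b, -z)"]) auto
    then show ?thesis using z M' by simp
  qed (use M in simp)
  have mg: "g \<in> borel_measurable borel" and mg': "g' \<in> borel_measurable borel"
    using cg cg' by (auto intro: borel_measurable_continuous_onI)
  have ig: "integrable lborel g" using cg S by (intro integrable_continuous_compact_support) auto
  have "(\<lambda>n. \<integral>x. q n x \<partial>lborel) \<longlonglongrightarrow> (\<integral>x. g' x \<partial>lborel)"
  proof (rule integral_dominated_convergence[where w = "\<lambda>x. M * indicator S' x"])
    show "integrable lborel (\<lambda>x. M * indicator S' x)"
      using S' emeasure_compact_finite[OF S'] by (auto intro!: integrable_mult_right simp: compact_imp_closed)
    show "AE x in lborel. (\<lambda>n. q n x) \<longlonglongrightarrow> g' x"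
    proof (rule AE_I2)
      fix x
      have "((\<lambda>h. (g (x + h *\<^sub>R b) - g x) / h) \<longlongrightarrow> g' x) (at 0)"
        using der[of x] by (simp add: DERIV_def)
      moreover have "filterlim (\<lambda>n. 1 / real (Suc n)) (at 0) sequentially"
        using LIMSEQ_Suc[OF lim_inverse_n'] by (auto simp: filterlim_at)
      ultimately show "(\<lambda>n. q n x) \<longlonglongrightarrow> g' x"
        unfolding q_def by (rule filterlim_compose)
    qed
    show "AE x in lborel. norm (q n x) \<le> M * indicator S' x" for n using qb by auto
  qed (use mg mg' in \<open>auto simp: q_def\<close>)
  moreover have "(\<integral>x. q n x \<partial>lborel) = 0" for n
  proof -
    have "(\<integral>x. g (x + (1 / Suc n) *\<^sub>R b) - g x \<partial>lborel) = 0"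
      using lborel_integral_translation[OF mg, of "(1 / Suc n) *\<^sub>R b"]
        lborel_integrable_translation[OF ig, of "(1 / Suc n) *\<^sub>R b"] ig
      by (simp add: add.commute)
    then show ?thesis unfolding q_def by simp
  qed
  ultimately have "(\<lambda>n. 0) \<longlonglongrightarrow> (\<integral>x. g' x \<partial>lborel)" by simp
  then show ?thesis using LIMSEQ_unique[OF _ tendsto_const] by metis
qed

text \<open>
  The integrand is the divergence of \<open>\<rho> \<nabla>\<phi>\<close>, because \<open>\<nabla>\<rho> = - \<Xi>(\<rho>) \<rho> \<nabla>\<Phi>\<close>; each of its summands is a
  directional derivative of a compactly supported function.
\<close>

lemma weak_equation_of_gradient_equation:
  fixes \<rho> :: "'a::euclidean_space \<Rightarrow> real"
  assumes der: "\<And>x. (\<rho> has_derivative (\<lambda>h. - \<Xi> (\<rho> x) * \<rho> x * (grad Phi x \<bullet> h))) (at x)"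
    and cont: "continuous_on UNIV (\<lambda>x. \<Xi> (\<rho> x))"
    and test: "test_function \<phi>"
  shows "(\<integral>x. \<rho> x * laplacian \<phi> x - \<Xi> (\<rho> x) * \<rho> x * (grad Phi x \<bullet> grad \<phi> x) \<partial>lborel) = 0"
proof -
  define S where "S = closure {x. \<phi> x \<noteq> 0}"
  have S: "compact S" using test by (simp add: S_def test_function_def)
  have "C_class (Suc (Suc 0)) \<phi>" using test by (simp add: test_function_def del: C_class.simps)
  then have C1: "\<And>b. b \<in> Basis \<Longrightarrow> C_class 1 (\<lambda>x. grad \<phi> x \<bullet> b)"
    by (metis C_class.simps(2) One_nat_def)
  have c2: "continuous_on UNIV (\<lambda>x. grad \<phi> x \<bullet> b)" if "b \<in> Basis" for b
    using C_class_1D(2)[OF C1[OF that]] .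
  have zero: "grad \<phi> x = 0" if "x \<notin> S" for x
    using outside_support_zero[of x \<phi>] that by (simp add: S_def)
  have zero2: "grad (\<lambda>x. grad \<phi> x \<bullet> b) x = 0" if "x \<notin> S" for x b
  proof (rule outside_support_zero)
    have "closure {x. grad \<phi> x \<bullet> b \<noteq> 0} \<subseteq> S"
    proof (rule closure_minimal)
      show "{x. grad \<phi> x \<bullet> b \<noteq> 0} \<subseteq> S" using zero by force
    qed (simp add: S_def)
    then show "x \<notin> closure {x. grad \<phi> x \<bullet> b \<noteq> 0}" using that by blast
  qed
  have c\<rho>: "continuous_on UNIV \<rho>"
    using der has_derivative_continuous by (fastforce simp: continuous_on_eq_continuous_at)
  define g' where "g' = (\<lambda>b x. \<rho> x * (grad (\<lambda>x. grad \<phi> x \<bullet> b) x \<bullet> b)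
      - \<Xi> (\<rho> x) * \<rho> x * (2 * (x \<bullet> b)) * (grad \<phi> x \<bullet> b))"
  have cg': "continuous_on UNIV (g' b)" if "b \<in> Basis" for b
    unfolding g'_def
    by (intro continuous_on_diff continuous_on_mult c\<rho> cont c2 that continuous_on_inner
        C_class_1D(3)[OF C1[OF that]] continuous_on_const continuous_on_id)
  have int: "(\<integral>x. g' b x \<partial>lborel) = 0" if b: "b \<in> Basis" for b
  proof (rule integral_directional_derivative_eq_0[where g = "\<lambda>x. \<rho> x * (grad \<phi> x \<bullet> b)" and b = b and S = S])
    fix x
    have "((\<lambda>t. grad \<phi> (x + t *\<^sub>R b) \<bullet> b) has_real_derivative grad (\<lambda>x. grad \<phi> x \<bullet> b) x \<bullet> b) (at 0)"
      using line_derivative_grad[of "\<lambda>x. grad \<phi> x \<bullet> b" x 0 b] C_class_1D(1)[OF C1[OF b]] by simp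
    moreover have "((\<lambda>t. \<rho> (x + t *\<^sub>R b)) has_real_derivative - \<Xi> (\<rho> x) * \<rho> x * (2 * (x \<bullet> b))) (at 0)"
    proof -
      have "grad \<rho> x = - (\<Xi> (\<rho> x) * \<rho> x) *\<^sub>R grad Phi x"
        using der[of x] by (intro grad_eqI) simp
      moreover have "\<rho> differentiable (at x)" using der by (auto simp: differentiable_def)
      ultimately show ?thesis
        using line_derivative_grad[of \<rho> x 0 b] by (simp add: grad_Phi mult.assoc)
    qed
    ultimately show "((\<lambda>t. \<rho> (x + t *\<^sub>R b) * (grad \<phi> (x + t *\<^sub>R b) \<bullet> b)) has_real_derivative g' b x) (at 0)"
      by (auto intro!: derivative_eq_intros simp: g'_def)
    show "g' b x = 0" if "x \<notin> S" using zero zero2 that by (simp add: g'_def)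
  qed (use cg' S c\<rho> C_class_1D(2)[OF C1] b zero in \<open>auto intro!: continuous_on_mult\<close>)
  have "\<rho> x * laplacian \<phi> x - \<Xi> (\<rho> x) * \<rho> x * (grad Phi x \<bullet> grad \<phi> x) = (\<Sum>b\<in>Basis. g' b x)" for x
  proof -
    have "laplacian \<phi> x = (\<Sum>b\<in>Basis. grad (\<lambda>x. grad \<phi> x \<bullet> b) x \<bullet> b)"
      using C_class_1D(1)[OF C1] by (intro laplacian_eq_sum)
    moreover have "grad Phi x \<bullet> grad \<phi> x = (\<Sum>b\<in>Basis. 2 * (x \<bullet> b) * (grad \<phi> x \<bullet> b))"
      unfolding grad_Phi by (subst euclidean_inner) simp
    ultimately show ?thesis
      by (simp add: g'_def sum_subtractf sum_distrib_left mult.assoc)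
  qed
  moreover have "integrable lborel (g' b)" if "b \<in> Basis" for b
    using cg'[OF that] S zero zero2
    by (intro integrable_continuous_compact_support[where S = S]) (auto simp: g'_def)
  ultimately show ?thesis using int by simp
qed

text \<open>
  Up to a shift of the argument, \<open>exp \<circ> v\<close> is the inverse of \<open>g r = \<integral> ds / (s \<Xi>(s))\<close>, taken over \<open>[1, r]\<close>, and
  this is the formula \<open>\<pi> x = g\<inverse> (\<mu> - \<Phi> x)\<close>.  The normalizing shift \<open>m\<close> exists because
  \<open>\<kappa> \<le> v' \<le> K\<close> forces the logarithm of the total mass \<open>Z m\<close> to grow at a rate between \<open>\<kappa>\<close> and \<open>K\<close>.
\<close>

lemma radial_stationary_density:
  fixes \<Xi> v :: "real \<Rightarrow> real"
  assumes cont: "continuous_on {0..} \<Xi>"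
    and bounds: "\<And>r. 0 \<le> r \<Longrightarrow> \<kappa> \<le> \<Xi> r \<and> \<Xi> r \<le> K"
    and \<kappa>: "0 < \<kappa>"
    and v: "\<And>t. (v has_real_derivative \<Xi> (exp (v t))) (at t)"
  obtains m where "stationary_density \<Xi> (\<lambda>x::'a::euclidean_space. exp (v (m - (norm x)\<^sup>2)))"
proof -
  note inc = derivative_bounds_imp_increment_bounds[of v "\<lambda>t. \<Xi> (exp (v t))" \<kappa> K, OF v]
  have inc1: "\<kappa> * (t - s) \<le> v t - v s" and inc2: "v t - v s \<le> K * (t - s)" if "s \<le> t" for s t
    using inc that bounds by auto
  have cv: "continuous_on UNIV v"
    using v DERIV_isCont by (auto simp: continuous_on_eq_continuous_at)
  define \<rho> where "\<rho> = (\<lambda>m (x::'a). exp (v (m - (norm x)\<^sup>2)))"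
  have c\<rho>: "continuous_on UNIV (\<rho> m)" for m
    unfolding \<rho>_def
    by (intro continuous_on_exp continuous_on_compose2[OF cv]) (auto intro!: continuous_intros)
  have meas: "\<rho> m \<in> borel_measurable borel" for m
    using c\<rho> by (rule borel_measurable_continuous_onI)
  have int: "integrable lborel (\<rho> m)" for m
  proof (rule Bochner_Integration.integrable_bound)
    show "integrable lborel (\<lambda>x::'a. exp (v m) * exp (- \<kappa> * (norm x)\<^sup>2))"
      using integrable_gaussian_weight[OF \<kappa>] by simp
    show "AE x in lborel. norm (\<rho> m x) \<le> norm (exp (v m) * exp (- \<kappa> * (norm x)\<^sup>2))"
    proof (rule AE_I2)
      fix x :: 'a
      show "norm (\<rho> m x) \<le> norm (exp (v m) * exp (- \<kappa> * (norm x)\<^sup>2))"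
        using inc1[of "m - (norm x)\<^sup>2" m] by (simp add: \<rho>_def exp_add[symmetric])
    qed
  qed (use meas in simp)
  define Z where "Z = (\<lambda>m. \<integral>x. \<rho> m x \<partial>lborel)"
  have Zinc: "exp (\<kappa> * (t - s)) * Z s \<le> Z t \<and> Z t \<le> exp (K * (t - s)) * Z s" if "s \<le> t" for s t
  proof -
    have "exp (\<kappa> * (t - s)) * \<rho> s x \<le> \<rho> t x \<and> \<rho> t x \<le> exp (K * (t - s)) * \<rho> s x" for x
      using inc1[of "s - (norm x)\<^sup>2" "t - (norm x)\<^sup>2"] inc2[of "s - (norm x)\<^sup>2" "t - (norm x)\<^sup>2"] that
      by (simp add: \<rho>_def exp_add[symmetric])
    then have "(\<integral>x. exp (\<kappa> * (t - s)) * \<rho> s x \<partial>lborel) \<le> Z t \<and> Z t \<le> (\<integral>x. exp (K * (t - s)) * \<rho> s x \<partial>lborel)"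
      unfolding Z_def using int by (intro conjI integral_mono) auto
    then show ?thesis by (simp add: Z_def)
  qed
  have Zpos: "0 < Z m" for m
  proof -
    have "Z m \<noteq> 0"
    proof
      assume "Z m = 0"
      then have "AE x in lborel. \<rho> m x = 0"
        using integral_nonneg_eq_0_iff_AE[OF int[of m]] by (simp add: Z_def \<rho>_def)
      then have "AE x in (lborel :: 'a measure). False" by (simp add: \<rho>_def)
      then show False by (simp add: trivial_limit_def[symmetric] ae_filter_eq_bot_iff)
    qed
    moreover have "0 \<le> Z m" unfolding Z_def by (intro Bochner_Integration.integral_nonneg) (simp add: \<rho>_def)
    ultimately show ?thesis by simp
  qed
  have lnZ: "\<kappa> * (t - s) \<le> ln (Z t) - ln (Z s) \<and> ln (Z t) - ln (Z s) \<le> K * (t - s)" if "s \<le> t" for s t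
  proof -
    have "ln (exp (\<kappa> * (t - s)) * Z s) \<le> ln (Z t)" "ln (Z t) \<le> ln (exp (K * (t - s)) * Z s)"
      using Zinc[OF that] Zpos[of s] Zpos[of t] by (auto intro: ln_mono)
    then show ?thesis using Zpos by (simp add: ln_mult_pos)
  qed
  have "bij (\<lambda>m. ln (Z m))"
    using bilipschitz_increasing_homeo(2)[of \<kappa> "\<lambda>m. ln (Z m)" K] lnZ \<kappa> by blast
  then obtain m where "ln (Z m) = 0" by (metis bij_pointE)
  then have Zm: "Z m = 1" using Zpos[of m] by simp
  have "(\<rho> m has_derivative (\<lambda>h. - \<Xi> (\<rho> m x) * \<rho> m x * (grad Phi x \<bullet> h))) (at x)" for x
  proof -
    have 1: "((\<lambda>x::'a. m - x \<bullet> x) has_derivative (\<lambda>h. - (2 * (x \<bullet> h)))) (at x)"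
      by (auto intro!: derivative_eq_intros simp: inner_commute)
    have 2: "((\<lambda>t. exp (v t)) has_derivative (\<lambda>h. \<Xi> (exp (v (m - x \<bullet> x))) * exp (v (m - x \<bullet> x)) * h)) (at (m - x \<bullet> x))"
      using v[of "m - x \<bullet> x"] unfolding has_field_derivative_def[symmetric]
      by (auto intro!: derivative_eq_intros)
    have "((\<lambda>t. exp (v t)) \<circ> (\<lambda>x. m - x \<bullet> x) has_derivative
       (\<lambda>h. \<Xi> (exp (v (m - x \<bullet> x))) * exp (v (m - x \<bullet> x)) * h) \<circ> (\<lambda>h. - (2 * (x \<bullet> h)))) (at x)"
      by (rule diff_chain_at[OF 1 2])
    then show ?thesis
      unfolding \<rho>_def power2_norm_eq_inner grad_Phi by (simp add: o_def mult.assoc)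
  qed
  moreover have "continuous_on UNIV (\<lambda>x. \<Xi> (\<rho> m x))"
    by (rule continuous_on_compose2[OF cont c\<rho>]) (auto simp: \<rho>_def)
  ultimately have "stationary_density \<Xi> (\<rho> m)"
    unfolding stationary_density_def prob_density_def
    using weak_equation_of_gradient_equation[of "\<rho> m" \<Xi>] int[of m] Zm
    by (auto simp: has_bochner_integral_iff Z_def) (simp add: \<rho>_def)
  then show thesis by (intro that[of m]) (simp add: \<rho>_def)
qed

section \<open>The Gaussian Log-Sobolev inequality on an interval\<close>

text \<open>
  With \<open>G\<close> and \<open>H\<close> the distribution functions of \<open>p\<close> and \<open>q\<close>, the map is \<open>T = H\<inverse> \<circ> G\<close>.  Equal masses
  make it fix both end points.
\<close>

lemma monotone_transport_on_interval:
  fixes p q :: "real \<Rightarrow> real"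
  assumes lr: "l < r"
    and p: "continuous_on UNIV p" "\<And>x. 0 < p x" and q: "continuous_on UNIV q" "\<And>x. 0 < q x"
    and mass: "integral {l..r} p = integral {l..r} q"
  obtains T where "continuous_on {l..r} T" "T l = l" "T r = r"
    "\<And>x. l < x \<Longrightarrow> x < r \<Longrightarrow> (T has_real_derivative p x / q (T x)) (at x)"
proof -
  define G where "G = (\<lambda>x. integral {l..x} p)"
  define H where "H = (\<lambda>x. integral {l..x} q)"
  have dG: "(G has_real_derivative p x) (at x within {l..r})"
   and dH: "(H has_real_derivative q x) (at x within {l..r})" if "x \<in> {l..r}" for x
    unfolding G_def H_def
    by (rule integral_has_real_derivative[OF continuous_on_subset[OF p(1) subset_UNIV] that],
        rule integral_has_real_derivative[OF continuous_on_subset[OF q(1) subset_UNIV] that])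
  have at_in: "(at x within {l..r}) = at x" if "l < x" "x < r" for x :: real
    using that by (rule at_within_Icc_at)
  have cG: "continuous_on {l..r} G"
    by (rule DERIV_continuous_on) (rule dG)
  have cH: "continuous_on {l..r} H"
    by (rule DERIV_continuous_on) (rule dH)
  have smH: "H x < H y" if "l \<le> x" "x < y" "y \<le> r" for x y
  proof (rule DERIV_pos_imp_increasing_open[OF \<open>x < y\<close>])
    show "\<exists>D. DERIV H z :> D \<and> 0 < D" if z: "x < z" "z < y" for z
    proof (intro exI conjI)
      have lz: "l < z" "z < r" using z \<open>l \<le> x\<close> \<open>y \<le> r\<close> by auto
      then show "DERIV H z :> q z" using dH[of z] at_in[OF lz] by simp
    qed (rule q(2))
    show "continuous_on {x..y} H" using cH that by (auto intro: continuous_on_subset)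
  qed
  have smG: "G x < G y" if "l \<le> x" "x < y" "y \<le> r" for x y
  proof (rule DERIV_pos_imp_increasing_open[OF \<open>x < y\<close>])
    show "\<exists>D. DERIV G z :> D \<and> 0 < D" if z: "x < z" "z < y" for z
    proof (intro exI conjI)
      have lz: "l < z" "z < r" using z \<open>l \<le> x\<close> \<open>y \<le> r\<close> by auto
      then show "DERIV G z :> p z" using dG[of z] at_in[OF lz] by simp
    qed (rule p(2))
    show "continuous_on {x..y} G" using cG that by (auto intro: continuous_on_subset)
  qed
  have ends: "G l = 0" "H l = 0" "G r = H r" using mass by (auto simp: G_def H_def)
  have injH: "inj_on H {l..r}"
    using smH by (intro linorder_inj_onI) (auto simp: less_imp_neq)
  have imH: "H ` {l..r} = {0..H r}"
  proof (intro equalityI subsetI)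
    fix y assume "y \<in> H ` {l..r}"
    then obtain x where "y = H x" "l \<le> x" "x \<le> r" by auto
    then show "y \<in> {0..H r}"
      using smH[of l x] smH[of x r] ends by (cases "x = l"; cases "x = r") (auto simp: less_imp_le)
  next
    fix y assume "y \<in> {0..H r}"
    then have "\<exists>x\<ge>l. x \<le> r \<and> H x = y" using ends lr cH by (intro IVT') auto
    then show "y \<in> H ` {l..r}" by auto
  qed
  have Grange: "G x \<in> {0..H r}" if "x \<in> {l..r}" for x
    using smG[of l x] smG[of x r] ends that by (cases "x = l"; cases "x = r") (auto simp: less_imp_le)
  define J where "J = the_inv_into {l..r} H"
  have JH: "J (H x) = x" if "x \<in> {l..r}" for x
    unfolding J_def using injH that by (rule the_inv_into_f_f)
  have HJ: "H (J y) = y" and Jr: "J y \<in> {l..r}" if "y \<in> {0..H r}" for y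
    using that f_the_inv_into_f[OF injH, of y] the_inv_into_into[OF injH, of y "{l..r}"] imH
    by (auto simp: J_def)
  have cJ: "continuous_on {0..H r} J"
    using continuous_on_inv[OF cH compact_Icc, of J] JH imH by auto
  define T where "T = (\<lambda>x. J (G x))"
  have "continuous_on {l..r} T"
    unfolding T_def by (rule continuous_on_compose2[OF cJ cG]) (use Grange in auto)
  moreover have "T l = l" "T r = r"
    using JH[of l] JH[of r] ends lr by (auto simp: T_def)
  moreover have "(T has_real_derivative p x / q (T x)) (at x)" if x: "l < x" "x < r" for x
  proof -
    have Gx: "0 < G x" "G x < H r" using smG[of l x] smG[of x r] ends x by auto
    have Tx: "l < T x" "T x < r"
    proof -
      have "T x \<noteq> l" "T x \<noteq> r" using HJ[of "G x"] Gx ends by (auto simp: T_def)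
      then show "l < T x" "T x < r" using Jr[of "G x"] Gx by (auto simp: T_def)
    qed
    have "(J has_real_derivative inverse (q (T x))) (at (G x))"
    proof (rule DERIV_inverse_function[where f = H and a = 0 and b = "H r"])
      show "DERIV H (J (G x)) :> q (T x)"
        using dH[of "T x"] at_in[of "T x"] Tx by (simp add: T_def)
      show "q (T x) \<noteq> 0" using q(2)[of "T x"] by simp
      show "H (J y) = y" if "0 < y" "y < H r" for y using HJ that by auto
      show "isCont J (G x)"
        using cJ Gx continuous_on_interior[of "{0..H r}" J "G x"] by (simp add: interior_atLeastAtMost_real)
    qed (use Gx in auto)
    moreover have "(G has_real_derivative p x) (at x)" using dG[of x] at_in[of x] x by simp
    ultimately show ?thesis unfolding T_def
      using DERIV_chain2[of J "inverse (q (J (G x)))" G x "p x"] by (simp add: T_def field_simps)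
  qed
  ultimately show thesis using that by blast
qed

text \<open>
  A transport argument after Cordero-Erausquin.  On a bounded interval, and for equal masses, the
  displacement \<open>T x - x\<close> vanishes at both ends, so the integration by parts has no boundary terms.
\<close>

lemma gaussian_log_sobolev_interval_normalized:
  fixes F F' :: "real \<Rightarrow> real"
  assumes lr: "l < r" and a: "0 < a"
    and F: "\<And>x. 0 < F x" "\<And>x. (F has_real_derivative F' x) (at x)" "continuous_on UNIV F'"
    and mass: "integral {l..r} (\<lambda>x. F x * exp (- a * x\<^sup>2)) = integral {l..r} (\<lambda>x. exp (- a * x\<^sup>2))"
  shows "integral {l..r} (\<lambda>x. F x * ln (F x) * exp (- a * x\<^sup>2))
     \<le> 1 / (4 * a) * integral {l..r} (\<lambda>x. (F' x)\<^sup>2 / F x * exp (- a * x\<^sup>2))"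
proof -
  define w where "w = (\<lambda>x. exp (- a * x\<^sup>2))"
  have cF: "continuous_on UNIV F"
    using F(2) DERIV_isCont by (auto simp: continuous_on_eq_continuous_at)
  have cw: "continuous_on UNIV w" unfolding w_def by (intro continuous_intros)
  have wpos: "0 < w x" for x by (simp add: w_def)
  note sub = continuous_on_subset[OF _ subset_UNIV]
  have cFw: "continuous_on UNIV (\<lambda>x. F x * w x)" using cF cw by (rule continuous_on_mult)
  have "integral {l..r} (\<lambda>x. F x * w x) = integral {l..r} w" using mass by (simp add: w_def)
  then obtain T where T: "continuous_on {l..r} T" "T l = l" "T r = r"
    "\<And>x. l < x \<Longrightarrow> x < r \<Longrightarrow> (T has_real_derivative F x * w x / w (T x)) (at x)"
    using monotone_transport_on_interval[OF lr cFw _ cw wpos] F(1) wpos by auto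
  define T' where "T' = (\<lambda>x. F x * w x / w (T x))"
  \<comment> \<open>\<open>Q\<close> is the boundary term; its derivative collects the terms to be integrated by parts.\<close>
  define Q where "Q = (\<lambda>x. (T x - x) * F x * w x)"
  define Q' where "Q' = (\<lambda>x. (T' x - 1) * F x * w x + (T x - x) * F' x * w x
      - 2 * a * x * (T x - x) * F x * w x)"
  have cwT: "continuous_on {l..r} (\<lambda>x. w (T x))"
    by (rule continuous_on_compose2[OF cw T(1)]) auto
  have cT': "continuous_on {l..r} T'"
    unfolding T'_def using wpos
    by (intro continuous_intros cwT sub[OF cF] sub[OF cw]) (auto simp: less_imp_neq[symmetric])
  have cQ': "continuous_on {l..r} Q'"
    unfolding Q'_def
    by (intro continuous_intros cT' T(1) sub[OF cF] sub[OF cw] sub[OF F(3)])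
  have Q: "(Q' has_integral Q r - Q l) {l..r}"
  proof (rule fundamental_theorem_of_calculus_interior)
    show "continuous_on {l..r} Q"
      unfolding Q_def by (intro continuous_intros T(1) sub[OF cF] sub[OF cw])
    fix x assume x: "x \<in> {l<..<r}"
    have "(w has_real_derivative - 2 * a * x * w x) (at x)"
      unfolding w_def by (auto intro!: derivative_eq_intros)
    moreover have "(T has_real_derivative T' x) (at x)" using T(4)[of x] x by (simp add: T'_def)
    ultimately have "(Q has_real_derivative Q' x) (at x)"
      unfolding Q_def Q'_def using F(2)[of x]
      by (auto intro!: derivative_eq_intros simp: algebra_simps)
    then show "(Q has_vector_derivative Q' x) (at x)"
      by (simp add: has_real_derivative_iff_has_vector_derivative)
  qed (use lr in simp)
  have Q0: "integral {l..r} Q' = 0"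
    using integral_unique[OF Q] T by (simp add: Q_def)
  have point: "F x * ln (F x) * w x \<le> Q' x + 1 / (4 * a) * ((F' x)\<^sup>2 / F x * w x)" for x
  proof -
    define \<theta> where "\<theta> = T x - x"
    have T'pos: "0 < T' x" using F(1)[of x] wpos by (simp add: T'_def)
    have "F x = T' x * w (T x) / w x" using wpos[of x] wpos[of "T x"] by (simp add: T'_def)
    then have "ln (F x) = ln (T' x) + ln (w (T x)) - ln (w x)"
      using T'pos wpos[of x] wpos[of "T x"] by (simp add: ln_div ln_mult_pos)
    also have "\<dots> = ln (T' x) - 2 * a * x * \<theta> - a * \<theta>\<^sup>2"
      by (simp add: w_def \<theta>_def power2_eq_square algebra_simps)
    also have "\<dots> \<le> T' x - 1 - 2 * a * x * \<theta> - a * \<theta>\<^sup>2"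
      using ln_le_minus_one[OF T'pos] by simp
    finally have 1: "ln (F x) \<le> T' x - 1 - 2 * a * x * \<theta> - a * \<theta>\<^sup>2" .
    \<comment> \<open>completing the square\<close>
    have "0 \<le> (F' x + 2 * a * \<theta> * F x)\<^sup>2 / (4 * a * F x)"
      using F(1)[of x] a by simp
    also have "\<dots> = 1 / (4 * a) * ((F' x)\<^sup>2 / F x) + \<theta> * F' x + a * \<theta>\<^sup>2 * F x"
      using F(1)[of x] a by (simp add: field_simps power2_eq_square)
    finally have 2: "- a * \<theta>\<^sup>2 * F x \<le> 1 / (4 * a) * ((F' x)\<^sup>2 / F x) + \<theta> * F' x" by simp
    have "F x * ln (F x) \<le> F x * (T' x - 1 - 2 * a * x * \<theta> - a * \<theta>\<^sup>2)"
      using 1 F(1)[of x] by (intro mult_left_mono) auto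
    also have "\<dots> \<le> (T' x - 1) * F x + \<theta> * F' x - 2 * a * x * \<theta> * F x + 1 / (4 * a) * ((F' x)\<^sup>2 / F x)"
      using 2 by (simp add: algebra_simps)
    finally have "F x * ln (F x) * w x \<le> ((T' x - 1) * F x + \<theta> * F' x - 2 * a * x * \<theta> * F x
        + 1 / (4 * a) * ((F' x)\<^sup>2 / F x)) * w x"
      using wpos[of x] by (intro mult_right_mono) auto
    then show ?thesis by (simp add: Q'_def \<theta>_def algebra_simps)
  qed
  have c1: "continuous_on {l..r} (\<lambda>x. F x * ln (F x) * w x)"
    using F(1) by (intro continuous_intros sub[OF cF] sub[OF cw]) (auto simp: less_imp_neq[symmetric])
  have c2: "continuous_on {l..r} (\<lambda>x. 1 / (4 * a) * ((F' x)\<^sup>2 / F x * w x))"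
    using F(1) by (intro continuous_intros sub[OF cF] sub[OF cw] sub[OF F(3)]) (auto simp: less_imp_neq[symmetric])
  have "integral {l..r} (\<lambda>x. F x * ln (F x) * w x)
      \<le> integral {l..r} (\<lambda>x. Q' x + 1 / (4 * a) * ((F' x)\<^sup>2 / F x * w x))"
    using point c1 c2 cQ'
    by (intro integral_le) (auto intro!: integrable_continuous_real continuous_on_add)
  also have "\<dots> = integral {l..r} Q' + 1 / (4 * a) * integral {l..r} (\<lambda>x. (F' x)\<^sup>2 / F x * w x)"
    using c2 cQ' by (subst integral_add) (auto intro!: integrable_continuous_real simp del: times_divide_eq_left)
  finally show ?thesis by (simp add: Q0 w_def)
qed

text \<open>
  Both sides are homogeneous of degree 1 in \<open>F\<close>, so \<open>F\<close> may be scaled to the mass of the weight.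
\<close>

lemma gaussian_log_sobolev_interval:
  fixes F F' :: "real \<Rightarrow> real"
  assumes lr: "l < r" and a: "0 < a"
    and F: "\<And>x. 0 < F x" "\<And>x. (F has_real_derivative F' x) (at x)" "continuous_on UNIV F'"
  defines "N \<equiv> integral {l..r} (\<lambda>x. exp (- a * x\<^sup>2))"
    and "M \<equiv> integral {l..r} (\<lambda>x. F x * exp (- a * x\<^sup>2))"
  shows "integral {l..r} (\<lambda>x. F x * ln (F x) * exp (- a * x\<^sup>2)) - M * ln (M / N)
     \<le> 1 / (4 * a) * integral {l..r} (\<lambda>x. (F' x)\<^sup>2 / F x * exp (- a * x\<^sup>2))"
proof -
  have cF: "continuous_on {l..r} F"
    using F(2) DERIV_isCont by (intro continuous_at_imp_continuous_on) blast
  have N: "0 < N" unfolding N_def using lr by (intro integral_Icc_pos continuous_intros) auto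
  have M: "0 < M" unfolding M_def using F(1) lr by (intro integral_Icc_pos continuous_intros cF) auto
  define c where "c = N / M"
  have c: "0 < c" using N M by (simp add: c_def)
  have ccF: "c * F x * exp (- a * x\<^sup>2) = c * (F x * exp (- a * x\<^sup>2))" for x by simp
  have "integral {l..r} (\<lambda>x. (c * F x) * ln (c * F x) * exp (- a * x\<^sup>2))
     \<le> 1 / (4 * a) * integral {l..r} (\<lambda>x. (c * F' x)\<^sup>2 / (c * F x) * exp (- a * x\<^sup>2))"
  proof (rule gaussian_log_sobolev_interval_normalized[OF lr a])
    show "integral {l..r} (\<lambda>x. c * F x * exp (- a * x\<^sup>2)) = integral {l..r} (\<lambda>x. exp (- a * x\<^sup>2))"
      unfolding ccF integral_mult_right N_def[symmetric] M_def[symmetric] using M by (simp add: c_def)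
  qed (use F c in \<open>auto intro!: derivative_eq_intros continuous_intros\<close>)
  also have "(\<lambda>x. (c * F' x)\<^sup>2 / (c * F x) * exp (- a * x\<^sup>2)) = (\<lambda>x. c * ((F' x)\<^sup>2 / F x * exp (- a * x\<^sup>2)))"
    using c by (auto simp: power2_eq_square)
  also have "(\<lambda>x. (c * F x) * ln (c * F x) * exp (- a * x\<^sup>2))
      = (\<lambda>x. c * (F x * ln (F x) * exp (- a * x\<^sup>2)) + c * ln c * (F x * exp (- a * x\<^sup>2)))"
    using c F(1) by (auto simp: ln_mult_pos algebra_simps)
  also have "integral {l..r} \<dots> = c * integral {l..r} (\<lambda>x. F x * ln (F x) * exp (- a * x\<^sup>2)) + c * ln c * M"
    unfolding M_def using F(1)
    by (subst integral_add) (auto intro!: integrable_continuous_real continuous_intros cF simp: less_imp_neq[symmetric])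
  finally have "c * (integral {l..r} (\<lambda>x. F x * ln (F x) * exp (- a * x\<^sup>2)) + ln c * M)
     \<le> c * (1 / (4 * a) * integral {l..r} (\<lambda>x. (F' x)\<^sup>2 / F x * exp (- a * x\<^sup>2)))"
    unfolding integral_mult_right by (simp add: algebra_simps)
  then have "integral {l..r} (\<lambda>x. F x * ln (F x) * exp (- a * x\<^sup>2)) + ln c * M
     \<le> 1 / (4 * a) * integral {l..r} (\<lambda>x. (F' x)\<^sup>2 / F x * exp (- a * x\<^sup>2))"
    using c by (simp only: mult_le_cancel_left_pos)
  moreover have "ln c = - ln (M / N)" using M N by (simp add: c_def ln_div)
  ultimately show ?thesis by (simp add: mult.commute)
qed

section \<open>Tensorization: the Gaussian Log-Sobolev inequality on a cube\<close>

abbreviation centered_cube :: "real \<Rightarrow> 'a::euclidean_space set" where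
  "centered_cube R \<equiv> cbox (- (R *\<^sub>R One)) (R *\<^sub>R One)"

definition box_weight :: "real \<Rightarrow> real \<Rightarrow> 'a::euclidean_space \<Rightarrow> real" where
  "box_weight a R x = indicator (centered_cube R) x * exp (- a * (norm x)\<^sup>2)"

text \<open>
  The one-dimensional factor of the weight on the cube, normalized so that averaging is a Markov
  operation; \<open>box_weight\<close> is not normalized.
\<close>

definition segment_weight :: "real \<Rightarrow> real \<Rightarrow> real \<Rightarrow> real" where
  "segment_weight a R t = indicator {-R..R} t * exp (- a * t\<^sup>2) / integral {-R..R} (\<lambda>t. exp (- a * t\<^sup>2))"

text \<open>
  The value at \<open>x\<close> is the average of \<open>F\<close> over the line through \<open>x\<close> in direction \<open>b\<close>: the coordinate
  \<open>x \<bullet> b\<close> is replaced by the integration variable.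
\<close>

definition coord_avg :: "real \<Rightarrow> real \<Rightarrow> 'a::euclidean_space \<Rightarrow> ('a \<Rightarrow> real) \<Rightarrow> 'a \<Rightarrow> real" where
  "coord_avg a R b F x = (\<integral>t. F (x + (t - x \<bullet> b) *\<^sub>R b) * segment_weight a R t \<partial>lborel)"

lemma mem_centered_cube:
  fixes x :: "'a::euclidean_space"
  shows "x \<in> centered_cube R \<longleftrightarrow> (\<forall>b\<in>Basis. - R \<le> x \<bullet> b \<and> x \<bullet> b \<le> R)"
  by (simp add: mem_box)

lemma box_centered_cube_nonempty:
  assumes "0 < R"
  shows "box (- (R *\<^sub>R One)) (R *\<^sub>R One :: 'a::euclidean_space) \<noteq> {}"
proof -
  have "(0::'a) \<in> box (- (R *\<^sub>R One)) (R *\<^sub>R One)" using assms by (simp add: mem_box)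
  then show ?thesis by blast
qed

lemma integrable_box_weight:
  fixes F :: "'a::euclidean_space \<Rightarrow> real"
  assumes "continuous_on UNIV F"
  shows "integrable lborel (\<lambda>x. F x * box_weight a R x)"
proof -
  have "continuous_on UNIV (\<lambda>x. F x * exp (- a * (norm x)\<^sup>2))"
    by (intro continuous_intros assms)
  then have "integrable lborel (\<lambda>x. indicator (centered_cube R) x * (F x * exp (- a * (norm x)\<^sup>2)))"
    by (rule integral_indicator_cbox(2)[OF continuous_on_subset[OF _ subset_UNIV]])
  then show ?thesis by (simp add: box_weight_def mult_ac)
qed

locale gaussian_box =
  fixes a R :: real and w :: "real \<Rightarrow> real" and Z :: real
  assumes a: "0 < a" and R: "0 < R"
  defines "w \<equiv> segment_weight a R"
    and "Z \<equiv> integral {-R..R} (\<lambda>t. exp (- a * t\<^sup>2))"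

begin

abbreviation "W \<equiv> box_weight a R"

abbreviation "avg \<equiv> coord_avg a R"

lemma Z_pos: "0 < Z"
  unfolding Z_def using R by (intro integral_Icc_pos continuous_intros) auto

lemma w_nonneg: "0 \<le> w t"
  using Z_pos by (simp add: w_def segment_weight_def Z_def)

lemma segment_integrable:
  assumes "continuous_on UNIV f"
  shows "integrable lborel (\<lambda>t. f t * w t)"
proof -
  have "integrable lborel (\<lambda>t. indicator {-R..R} t *\<^sub>R (f t * exp (- a * t\<^sup>2) / Z))"
    using Z_pos
    by (intro borel_integrable_compact compact_Icc continuous_intros continuous_on_subset[OF assms]) auto
  then show ?thesis by (simp add: w_def segment_weight_def Z_def mult_ac)
qed

lemma segment_integral:
  assumes "continuous_on UNIV f"
  shows "(\<integral>t. f t * w t \<partial>lborel) = integral {-R..R} (\<lambda>t. f t * exp (- a * t\<^sup>2)) / Z"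
proof -
  have "(\<integral>t. f t * w t \<partial>lborel) = (\<integral>t. indicator {-R..R} t * (f t * exp (- a * t\<^sup>2) / Z) \<partial>lborel)"
    by (rule Bochner_Integration.integral_cong) (auto simp: w_def segment_weight_def Z_def)
  also have "\<dots> = integral {-R..R} (\<lambda>t. f t * exp (- a * t\<^sup>2) / Z)"
  proof -
    have "continuous_on (cbox (-R) R) (\<lambda>t. f t * exp (- a * t\<^sup>2) / Z)"
      using Z_pos by (intro continuous_intros continuous_on_subset[OF assms]) auto
    from integral_indicator_cbox(1)[OF this] show ?thesis by simp
  qed
  finally show ?thesis by simp
qed

lemma w_integral: "(\<integral>t. w t \<partial>lborel) = 1"
  using segment_integral[of "\<lambda>_. 1"] Z_pos by (simp add: Z_def)

lemma continuous_on_line: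
  fixes F :: "'a::euclidean_space \<Rightarrow> real"
  assumes "continuous_on UNIV F"
  shows "continuous_on UNIV (\<lambda>t. F (x + (t - c) *\<^sub>R b))"
  by (rule continuous_on_compose2[OF assms]) (auto intro!: continuous_intros)

lemma avg_eq: "continuous_on UNIV F \<Longrightarrow>
    avg b F x = integral {-R..R} (\<lambda>t. F (x + (t - x \<bullet> b) *\<^sub>R b) * exp (- a * t\<^sup>2)) / Z"
  unfolding coord_avg_def w_def[symmetric] by (intro segment_integral continuous_on_line)

lemma continuous_on_avg:
  fixes F :: "'a::euclidean_space \<Rightarrow> real"
  assumes "continuous_on UNIV F"
  shows "continuous_on UNIV (avg b F)"
proof -
  have "continuous_on UNIV (\<lambda>x. integral (cbox (-R) R) (\<lambda>t. F (x + (t - x \<bullet> b) *\<^sub>R b) * exp (- a * t\<^sup>2)))"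
  proof (rule integral_continuous_on_param)
    show "continuous_on (UNIV \<times> cbox (-R) R) (\<lambda>(x, t). F (x + (t - x \<bullet> b) *\<^sub>R b) * exp (- a * t\<^sup>2))"
      unfolding split_beta
      by (intro continuous_intros continuous_on_compose2[OF assms]) auto
  qed
  then show ?thesis
    using Z_pos by (subst avg_eq[OF assms, abs_def]) (auto intro!: continuous_intros)
qed

lemma avg_pos:
  assumes "continuous_on UNIV F" "\<And>x. 0 < F x"
  shows "0 < avg b F x"
  unfolding avg_eq[OF assms(1)] using R Z_pos assms(2)
  by (intro divide_pos_pos integral_Icc_pos continuous_intros continuous_on_subset[OF continuous_on_line[OF assms(1)]]) auto

text \<open>
  Averaging in direction \<open>b\<close> removes the dependence on the coordinate \<open>b\<close>, and keeps independence of
  any other coordinate (next lemma).  After all directions only a constant is left.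
\<close>

lemma avg_line:
  assumes "b \<in> Basis"
  shows "avg b F (x + s *\<^sub>R b) = avg b F x"
proof -
  have "x + s *\<^sub>R b + (t - (x + s *\<^sub>R b) \<bullet> b) *\<^sub>R b = x + (t - x \<bullet> b) *\<^sub>R b" for t
    using assms by (simp add: inner_add_left algebra_simps)
  then show ?thesis by (simp only: coord_avg_def)
qed

lemma avg_indep:
  assumes "b \<in> Basis" "c \<in> Basis" "c \<noteq> b" "\<And>x s. F (x + s *\<^sub>R c) = F x"
  shows "avg b F (x + s *\<^sub>R c) = avg b F x"
proof -
  have "F (x + s *\<^sub>R c + (t - (x + s *\<^sub>R c) \<bullet> b) *\<^sub>R b) = F (x + (t - x \<bullet> b) *\<^sub>R b)" for t
  proof -
    have "x + s *\<^sub>R c + (t - (x + s *\<^sub>R c) \<bullet> b) *\<^sub>R b = (x + (t - x \<bullet> b) *\<^sub>R b) + s *\<^sub>R c"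
      using assms(1-3) by (simp add: inner_add_left inner_Basis algebra_simps)
    then show ?thesis by (simp only: assms(4))
  qed
  then show ?thesis by (simp only: coord_avg_def)
qed

text \<open>
  The weight on the cube is a product in which \<open>w\<close> carries the coordinate \<open>b\<close>, so the coordinates
  \<open>x \<bullet> b\<close> and \<open>s + x \<bullet> b\<close> may be exchanged.  This reversibility makes averaging preserve integrals.
\<close>

lemma detailed_balance:
  fixes x :: "'a::euclidean_space"
  assumes b: "b \<in> Basis"
  shows "W x * w (s + x \<bullet> b) = W (x + s *\<^sub>R b) * w (x \<bullet> b)"
proof -
  define B where "B = (centered_cube R :: 'a set)"
  have "x \<in> B \<and> s + x \<bullet> b \<in> {-R..R} \<longleftrightarrow> x + s *\<^sub>R b \<in> B \<and> x \<bullet> b \<in> {-R..R}"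
    unfolding mem_centered_cube B_def using b
    by (auto simp: inner_add_left inner_Basis add.commute split: if_splits)
  then have ind: "indicator B x * indicator {-R..R} (s + x \<bullet> b)
      = (indicator B (x + s *\<^sub>R b) * indicator {-R..R} (x \<bullet> b) :: real)"
    by (auto simp: indicator_def)
  have "(norm x)\<^sup>2 + (s + x \<bullet> b)\<^sup>2 = (norm (x + s *\<^sub>R b))\<^sup>2 + (x \<bullet> b)\<^sup>2"
    unfolding power2_norm_eq_inner using b
    by (simp add: inner_add_left inner_add_right inner_commute power2_eq_square algebra_simps)
  then have "exp (- a * ((norm x)\<^sup>2 + (s + x \<bullet> b)\<^sup>2)) = exp (- a * ((norm (x + s *\<^sub>R b))\<^sup>2 + (x \<bullet> b)\<^sup>2))"
    by (simp only:)
  then have "exp (- a * (norm x)\<^sup>2) * exp (- a * (s + x \<bullet> b)\<^sup>2)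
      = exp (- a * (norm (x + s *\<^sub>R b))\<^sup>2) * exp (- a * (x \<bullet> b)\<^sup>2)"
    by (simp only: distrib_left exp_add)
  with ind have "(indicator B x * indicator {-R..R} (s + x \<bullet> b)) * (exp (- a * (norm x)\<^sup>2) * exp (- a * (s + x \<bullet> b)\<^sup>2))
      = (indicator B (x + s *\<^sub>R b) * indicator {-R..R} (x \<bullet> b)) * (exp (- a * (norm (x + s *\<^sub>R b))\<^sup>2) * exp (- a * (x \<bullet> b)\<^sup>2))"
    by (simp only:)
  then show ?thesis
    unfolding box_weight_def w_def segment_weight_def Z_def[symmetric] B_def[symmetric]
    using Z_pos by (simp add: mult_ac)
qed

text \<open>
  If \<open>x\<close> lies in the cube and \<open>h (x, s)\<close> in the segment, then \<open>\<bar>s\<bar> \<le> 2 * R\<close>, so the integrand is bounded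
  with compact support.
\<close>

lemma integrable_pair:
  fixes C :: "'a::euclidean_space \<times> real \<Rightarrow> real"
  assumes C: "continuous_on UNIV C" and b: "b \<in> Basis"
    and h: "continuous_on UNIV h" "\<And>p. \<bar>snd p\<bar> \<le> \<bar>h p\<bar> + \<bar>fst p \<bullet> b\<bar>"
  shows "integrable (lborel \<Otimes>\<^sub>M lborel) (\<lambda>p. C p * W (fst p) * w (h p))"
proof -
  define B where "B = (centered_cube R :: 'a set)"
  define P where "P = h -` {-R..R}"
  have "closed P" unfolding P_def using h(1) by (intro closed_vimage closed_atLeastAtMost)
  then have P: "P \<in> sets borel" by (rule borel_closed)
  have cont: "continuous_on UNIV (\<lambda>p. C p * exp (- a * (norm (fst p))\<^sup>2) * (exp (- a * (h p)\<^sup>2) / Z))"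
    using Z_pos by (intro continuous_intros C h(1)) auto
  have "integrable (lborel :: ('a \<times> real) measure) (\<lambda>p. indicator (B \<times> {-2*R..2*R}) p *\<^sub>R
      (C p * exp (- a * (norm (fst p))\<^sup>2) * (exp (- a * (h p)\<^sup>2) / Z)))"
    unfolding B_def
    by (intro borel_integrable_compact compact_Times compact_cbox compact_Icc continuous_on_subset[OF cont]) auto
  from integrable_mult_indicator[OF _ this, of P] P
  have "integrable lborel (\<lambda>p. indicator P p *\<^sub>R (indicator (B \<times> {-2*R..2*R}) p *\<^sub>R
      (C p * exp (- a * (norm (fst p))\<^sup>2) * (exp (- a * (h p)\<^sup>2) / Z))))"
    by simp
  also have "(\<lambda>p. indicator P p *\<^sub>R (indicator (B \<times> {-2*R..2*R}) p *\<^sub>R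
      (C p * exp (- a * (norm (fst p))\<^sup>2) * (exp (- a * (h p)\<^sup>2) / Z)))) = (\<lambda>p. C p * W (fst p) * w (h p))"
  proof
    fix p :: "'a \<times> real"
    have "indicator P p * (indicator (B \<times> {-2*R..2*R}) p :: real) = indicator B (fst p) * indicator {-R..R} (h p)"
    proof (cases "fst p \<in> B \<and> h p \<in> {-R..R}")
      case True
      then have "\<bar>fst p \<bullet> b\<bar> \<le> R" using b unfolding B_def mem_centered_cube by auto
      moreover have "\<bar>snd p\<bar> \<le> \<bar>h p\<bar> + \<bar>fst p \<bullet> b\<bar>" by (rule h(2))
      ultimately have "snd p \<in> {-2*R..2*R}" using True by auto
      with True show ?thesis by (simp add: P_def indicator_def mem_Times_iff)
    qed (auto simp: P_def indicator_def mem_Times_iff)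
    then show "indicator P p *\<^sub>R (indicator (B \<times> {-2*R..2*R}) p *\<^sub>R
      (C p * exp (- a * (norm (fst p))\<^sup>2) * (exp (- a * (h p)\<^sup>2) / Z))) = C p * W (fst p) * w (h p)"
      unfolding box_weight_def w_def segment_weight_def Z_def[symmetric] B_def[symmetric]
      by (simp add: mult_ac)
  qed
  finally show ?thesis by (simp add: lborel_prod)
qed

text \<open>
  Written with the displacement \<open>s\<close>, the left side is a double integral over \<open>x\<close> and \<open>s\<close>.  Detailed balance
  followed by the translation \<open>x \<mapsto> x - s b\<close> moves the whole dependence on \<open>s\<close> into the factor
  \<open>w (x \<bullet> b - s)\<close>, whose integral over \<open>s\<close> is 1.
\<close>

lemma integral_avg:
  fixes F :: "'a::euclidean_space \<Rightarrow> real"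
  assumes F: "continuous_on UNIV F" and b: "b \<in> Basis"
  shows "(\<integral>x. avg b F x * W x \<partial>lborel) = (\<integral>x. F x * W x \<partial>lborel)"
proof -
  note mF = borel_measurable_continuous_onI[OF F]
  have mw: "w \<in> borel_measurable borel" unfolding w_def segment_weight_def by measurable
  have mW: "W \<in> borel_measurable borel"
    using borel_measurable_integrable[OF integrable_box_weight[OF continuous_on_const, of 1 a R]] by simp
  have avg1: "avg b F x * W x = (\<integral>s. F (x + s *\<^sub>R b) * W x * w (s + x \<bullet> b) \<partial>lborel)" for x
  proof -
    have m: "(\<lambda>t. F (x + (t - x \<bullet> b) *\<^sub>R b) * w t) \<in> borel_measurable borel"
      using mw borel_measurable_continuous_onI[OF continuous_on_line[OF F]] by measurable
    have "avg b F x = (\<integral>s. F (x + s *\<^sub>R b) * w (s + x \<bullet> b) \<partial>lborel)"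
      using lborel_integral_translation[OF m, of "x \<bullet> b"] by (simp add: coord_avg_def w_def add.commute)
    then have "avg b F x * W x = (\<integral>s. F (x + s *\<^sub>R b) * w (s + x \<bullet> b) * W x \<partial>lborel)" by simp
    then show ?thesis by (simp add: mult_ac)
  qed
  have int1: "integrable (lborel \<Otimes>\<^sub>M lborel) (\<lambda>(x, s). F (x + s *\<^sub>R b) * W x * w (s + x \<bullet> b))"
  proof -
    have "integrable (lborel \<Otimes>\<^sub>M lborel) (\<lambda>p. F (fst p + snd p *\<^sub>R b) * W (fst p) * w (snd p + fst p \<bullet> b))"
    proof (rule integrable_pair[OF _ b])
      show "\<bar>snd p\<bar> \<le> \<bar>snd p + fst p \<bullet> b\<bar> + \<bar>fst p \<bullet> b\<bar>" for p :: "'a \<times> real" by linarith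
    qed (auto intro!: continuous_intros continuous_on_compose2[OF F])
    then show ?thesis by (simp add: case_prod_beta')
  qed
  have int2: "integrable (lborel \<Otimes>\<^sub>M lborel) (\<lambda>(x, s). F x * W x * w (x \<bullet> b - s))"
  proof -
    have "integrable (lborel \<Otimes>\<^sub>M lborel) (\<lambda>p. F (fst p) * W (fst p) * w (fst p \<bullet> b - snd p))"
    proof (rule integrable_pair[OF _ b])
      show "\<bar>snd p\<bar> \<le> \<bar>fst p \<bullet> b - snd p\<bar> + \<bar>fst p \<bullet> b\<bar>" for p :: "'a \<times> real" by linarith
    qed (auto intro!: continuous_intros continuous_on_compose2[OF F])
    then show ?thesis by (simp add: case_prod_beta')
  qed
  have "(\<integral>x. avg b F x * W x \<partial>lborel) = (\<integral>x. (\<integral>s. F (x + s *\<^sub>R b) * W x * w (s + x \<bullet> b) \<partial>lborel) \<partial>lborel)"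
    by (simp add: avg1)
  also have "\<dots> = (\<integral>s. (\<integral>x. F (x + s *\<^sub>R b) * W x * w (s + x \<bullet> b) \<partial>lborel) \<partial>lborel)"
    using lborel_pair.Fubini_integral[OF int1] by simp
  also have "\<dots> = (\<integral>s. (\<integral>x. F x * W x * w (x \<bullet> b - s) \<partial>lborel) \<partial>lborel)"
  proof (rule Bochner_Integration.integral_cong[OF refl])
    fix s :: real
    have m: "(\<lambda>x. F x * W x * w (x \<bullet> b - s)) \<in> borel_measurable borel"
      using mF mW mw by measurable
    have "F (x + s *\<^sub>R b) * W x * w (s + x \<bullet> b) = F (s *\<^sub>R b + x) * W (s *\<^sub>R b + x) * w ((s *\<^sub>R b + x) \<bullet> b - s)" for x
      using detailed_balance[OF b, of x s] b by (simp add: inner_add_left add.commute mult.assoc)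
    then show "(\<integral>x. F (x + s *\<^sub>R b) * W x * w (s + x \<bullet> b) \<partial>lborel) = (\<integral>x. F x * W x * w (x \<bullet> b - s) \<partial>lborel)"
      using lborel_integral_translation[OF m, of "s *\<^sub>R b"] by simp
  qed
  also have "\<dots> = (\<integral>x. (\<integral>s. F x * W x * w (x \<bullet> b - s) \<partial>lborel) \<partial>lborel)"
    using lborel_pair.Fubini_integral[OF int2] by simp
  also have "\<dots> = (\<integral>x. F x * W x \<partial>lborel)"
  proof (rule Bochner_Integration.integral_cong[OF refl])
    fix x
    have "(\<integral>s. w (x \<bullet> b - s) \<partial>lborel) = 1"
      using lborel_integral_real_affine[of "-1" w "x \<bullet> b"] w_integral by simp
    then show "(\<integral>s. F x * W x * w (x \<bullet> b - s) \<partial>lborel) = F x * W x" by simp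
  qed
  finally show ?thesis .
qed

text \<open>
  The variational formula of entropy along one line: \<open>U = G / avg b G\<close> has average 1, and then
  \<open>avg (F ln U)\<close> is at most the entropy of \<open>F\<close>.  Pointwise it is \<open>ln y \<le> y - 1\<close>
  with \<open>y = m U / F\<close>, where \<open>m\<close> is the average of \<open>F\<close>.
\<close>

lemma avg_ln_le:
  fixes F G :: "'a::euclidean_space \<Rightarrow> real"
  assumes F: "continuous_on UNIV F" "\<And>x. 0 < F x" and G: "continuous_on UNIV G" "\<And>x. 0 < G x"
    and b: "b \<in> Basis"
  shows "avg b (\<lambda>x. F x * ln (G x / avg b G x)) x
     \<le> avg b (\<lambda>x. F x * ln (F x)) x - avg b F x * ln (avg b F x)"
proof -
  define f g where "f = (\<lambda>t. F (x + (t - x \<bullet> b) *\<^sub>R b))" and "g = (\<lambda>t. G (x + (t - x \<bullet> b) *\<^sub>R b))"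
  define m where "m = avg b F x"
  define k where "k = avg b G x"
  have cf: "continuous_on UNIV f" and cg: "continuous_on UNIV g"
    unfolding f_def g_def using F G by (auto intro!: continuous_on_line)
  have fpos: "0 < f t" and gpos: "0 < g t" for t using F G by (auto simp: f_def g_def)
  have m: "0 < m" "m = (\<integral>t. f t * w t \<partial>lborel)"
    using avg_pos F by (auto simp: m_def coord_avg_def f_def w_def)
  have k: "0 < k" "k = (\<integral>t. g t * w t \<partial>lborel)"
    using avg_pos G by (auto simp: k_def coord_avg_def g_def w_def)
  have point: "f t * ln (g t / k) \<le> f t * ln (f t) - ln m * f t + m / k * g t - f t" for t
  proof -
    define y where "y = m * g t / (k * f t)"
    have y: "0 < y" using m k fpos gpos by (simp add: y_def)
    have "ln (g t / k) - ln (f t) + ln m = ln y"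
      using m k fpos[of t] gpos[of t] by (simp add: y_def ln_div ln_mult_pos)
    also have "\<dots> \<le> y - 1" using y by (rule ln_le_minus_one)
    finally have "f t * (ln (g t / k) - ln (f t) + ln m) \<le> f t * (y - 1)"
      using fpos[of t] by (intro mult_left_mono) auto
    moreover have "f t * y = m / k * g t" using fpos[of t] by (simp add: y_def)
    ultimately show ?thesis by (simp add: algebra_simps)
  qed
  have c1: "continuous_on UNIV (\<lambda>t. f t * ln (f t))"
    using fpos by (intro continuous_intros cf) (auto simp: less_imp_neq[symmetric])
  have c0: "continuous_on UNIV (\<lambda>t. f t * ln (g t / k))"
    using gpos k(1) by (intro continuous_intros cf cg) (auto simp: less_imp_neq[symmetric])
  note ints = segment_integrable[OF c1] segment_integrable[OF cf] segment_integrable[OF cg]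
  have "(\<integral>t. (f t * ln (g t / k)) * w t \<partial>lborel)
     \<le> (\<integral>t. (f t * ln (f t)) * w t - ln m * (f t * w t) + m / k * (g t * w t) - f t * w t \<partial>lborel)"
  proof (rule integral_mono)
    show "integrable lborel (\<lambda>t. (f t * ln (g t / k)) * w t)" by (rule segment_integrable[OF c0])
    show "integrable lborel (\<lambda>t. (f t * ln (f t)) * w t - ln m * (f t * w t) + m / k * (g t * w t) - f t * w t)"
      by (intro Bochner_Integration.integrable_diff Bochner_Integration.integrable_add integrable_mult_right ints)
    show "(f t * ln (g t / k)) * w t \<le> (f t * ln (f t)) * w t - ln m * (f t * w t) + m / k * (g t * w t) - f t * w t" for t
      using mult_right_mono[OF point[of t] w_nonneg[of t]] by (simp add: algebra_simps)
  qed
  also have "\<dots> = (\<integral>t. (f t * ln (f t)) * w t \<partial>lborel) - ln m * m + m / k * k - m"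
    using ints by (simp add: Bochner_Integration.integrable_diff Bochner_Integration.integrable_add flip: m(2) k(2))
  finally have "(\<integral>t. (f t * ln (g t / k)) * w t \<partial>lborel) \<le> (\<integral>t. (f t * ln (f t)) * w t \<partial>lborel) - m * ln m"
    using k by (simp add: mult.commute)
  then show ?thesis
    unfolding coord_avg_def[of a R b "\<lambda>x. F x * ln (G x / avg b G x)"] coord_avg_def[of a R b "\<lambda>x. F x * ln (F x)"]
      avg_line[OF b] m_def[symmetric] k_def[symmetric] w_def[symmetric]
    by (simp add: f_def g_def)
qed

lemma avg_log_sobolev:
  fixes F :: "'a::euclidean_space \<Rightarrow> real"
  assumes F: "C_class 1 F" "\<And>x. 0 < F x" and b: "b \<in> Basis"
  shows "avg b (\<lambda>x. F x * ln (F x)) x - avg b F x * ln (avg b F x)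
    \<le> 1 / (4 * a) * avg b (\<lambda>x. (grad F x \<bullet> b)\<^sup>2 / F x) x"
proof -
  note C1 = C_class_1D[OF F(1)]
  define y where "y = x - (x \<bullet> b) *\<^sub>R b"
  have ln: "x + (t - x \<bullet> b) *\<^sub>R b = y + t *\<^sub>R b" for t by (simp add: y_def algebra_simps)
  define f f' where "f = (\<lambda>t. F (y + t *\<^sub>R b))" and "f' = (\<lambda>t. grad F (y + t *\<^sub>R b) \<bullet> b)"
  have cf': "continuous_on UNIV f'"
    unfolding f'_def by (intro continuous_intros continuous_on_compose2[OF C1(3)]) auto
  define M where "M = integral {-R..R} (\<lambda>t. f t * exp (- a * t\<^sup>2))"
  have main: "integral {-R..R} (\<lambda>t. f t * ln (f t) * exp (- a * t\<^sup>2)) - M * ln (M / Z)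
     \<le> 1 / (4 * a) * integral {-R..R} (\<lambda>t. (f' t)\<^sup>2 / f t * exp (- a * t\<^sup>2))"
    unfolding Z_def M_def
  proof (rule gaussian_log_sobolev_interval)
    show "(f has_real_derivative f' t) (at t)" for t
      unfolding f_def f'_def by (rule line_derivative_grad[OF C1(1)])
  qed (use R a F cf' in \<open>auto simp: f_def\<close>)
  have c1: "continuous_on UNIV (\<lambda>x. F x * ln (F x))"
    using F(2) by (intro continuous_intros C1) (auto simp: less_imp_neq[symmetric])
  have c2: "continuous_on UNIV (\<lambda>x. (grad F x \<bullet> b)\<^sup>2 / F x)"
    using F(2) by (intro continuous_intros C1) (auto simp: less_imp_neq[symmetric])
  have "avg b (\<lambda>x. F x * ln (F x)) x - avg b F x * ln (avg b F x)
     = (integral {-R..R} (\<lambda>t. f t * ln (f t) * exp (- a * t\<^sup>2)) - M * ln (M / Z)) / Z"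
    unfolding avg_eq[OF c1] avg_eq[OF C1(2)] ln by (simp add: f_def M_def diff_divide_distrib)
  also have "\<dots> \<le> (1 / (4 * a) * integral {-R..R} (\<lambda>t. (f' t)\<^sup>2 / f t * exp (- a * t\<^sup>2))) / Z"
    using main Z_pos by (intro divide_right_mono) auto
  also have "\<dots> = 1 / (4 * a) * avg b (\<lambda>x. (grad F x \<bullet> b)\<^sup>2 / F x) x"
    unfolding avg_eq[OF c2] ln by (simp add: f_def f'_def)
  finally show ?thesis .
qed

text \<open>
  Subadditivity of entropy.  \<open>G\<close> is \<open>F\<close> averaged over the directions in \<open>S\<close>.  Averaging over one more
  direction \<open>b\<close> changes \<open>\<integral> F ln G\<close> by \<open>\<integral> F ln (G / avg b G)\<close>, which by the variational formula and
  the one-dimensional inequality on each line costs only the \<open>b\<close>-part of the gradient of \<open>F\<close> itself.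
\<close>

lemma entropy_telescope:
  fixes F :: "'a::euclidean_space \<Rightarrow> real"
  assumes F: "C_class 1 F" "\<And>x. 0 < F x" and S: "finite S" "S \<subseteq> Basis"
  shows "\<exists>G. continuous_on UNIV G \<and> (\<forall>x. 0 < G x) \<and> (\<forall>b\<in>S. \<forall>x s. G (x + s *\<^sub>R b) = G x) \<and>
     (\<integral>x. G x * W x \<partial>lborel) = (\<integral>x. F x * W x \<partial>lborel) \<and>
     (\<integral>x. F x * ln (F x) * W x \<partial>lborel) - (\<integral>x. F x * ln (G x) * W x \<partial>lborel)
       \<le> 1 / (4 * a) * (\<Sum>b\<in>S. \<integral>x. (grad F x \<bullet> b)\<^sup>2 / F x * W x \<partial>lborel)"
  using S
proof (induction S rule: finite_induct)
  case empty
  show ?case using F C_class_1D[OF F(1)] by (intro exI[of _ F]) auto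
next
  case (insert b S)
  note C1 = C_class_1D[OF F(1)]
  have b: "b \<in> Basis" using insert.prems by simp
  from insert obtain G where G: "continuous_on UNIV G" "\<And>x. 0 < G x"
     "\<And>c x s. c \<in> S \<Longrightarrow> G (x + s *\<^sub>R c) = G x"
     "(\<integral>x. G x * W x \<partial>lborel) = (\<integral>x. F x * W x \<partial>lborel)"
     "(\<integral>x. F x * ln (F x) * W x \<partial>lborel) - (\<integral>x. F x * ln (G x) * W x \<partial>lborel)
       \<le> 1 / (4 * a) * (\<Sum>b\<in>S. \<integral>x. (grad F x \<bullet> b)\<^sup>2 / F x * W x \<partial>lborel)" by auto
  define H where "H = avg b G"
  have H: "continuous_on UNIV H" "\<And>x. 0 < H x"
    unfolding H_def by (rule continuous_on_avg[OF G(1)], rule avg_pos[OF G(1,2)])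
  have indep: "H (x + s *\<^sub>R c) = H x" if "c \<in> insert b S" for c x s
  proof (cases "c = b")
    case True
    then show ?thesis by (simp only: H_def avg_line[OF b])
  next
    case False
    with that have "c \<in> S" "c \<in> Basis" using insert.prems by auto
    with False show ?thesis unfolding H_def by (intro avg_indep[OF b]) (auto simp: G(3))
  qed
  have mass: "(\<integral>x. H x * W x \<partial>lborel) = (\<integral>x. F x * W x \<partial>lborel)"
    unfolding H_def using integral_avg[OF G(1) b] G(4) by simp
  have cE: "continuous_on UNIV (\<lambda>x. F x * ln (G x / H x))"
    and cG: "continuous_on UNIV (\<lambda>x. F x * ln (G x))"
    and cH: "continuous_on UNIV (\<lambda>x. F x * ln (H x))"
    and cD: "continuous_on UNIV (\<lambda>x. (grad F x \<bullet> b)\<^sup>2 / F x)"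
    using F(2) G(2) H(2)
    by (auto intro!: continuous_intros C1 G(1) H(1) simp: less_imp_neq[symmetric])
  have "(\<integral>x. F x * ln (G x) * W x \<partial>lborel) - (\<integral>x. F x * ln (H x) * W x \<partial>lborel)
      = (\<integral>x. F x * ln (G x) * W x - F x * ln (H x) * W x \<partial>lborel)"
    using integrable_box_weight[OF cG] integrable_box_weight[OF cH] by simp
  also have "\<dots> = (\<integral>x. F x * ln (G x / H x) * W x \<partial>lborel)"
    using G(2) H(2) by (intro Bochner_Integration.integral_cong refl)
       (simp add: ln_div algebra_simps less_imp_neq[symmetric])
  also have "\<dots> = (\<integral>x. avg b (\<lambda>x. F x * ln (G x / H x)) x * W x \<partial>lborel)"
    using integral_avg[OF cE b] by simp
  also have "\<dots> \<le> (\<integral>x. 1 / (4 * a) * avg b (\<lambda>x. (grad F x \<bullet> b)\<^sup>2 / F x) x * W x \<partial>lborel)"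
  proof (rule integral_mono)
    show "integrable lborel (\<lambda>x. avg b (\<lambda>x. F x * ln (G x / H x)) x * W x)"
      by (intro integrable_box_weight continuous_on_avg cE)
    show "integrable lborel (\<lambda>x. 1 / (4 * a) * avg b (\<lambda>x. (grad F x \<bullet> b)\<^sup>2 / F x) x * W x)"
      by (intro integrable_box_weight continuous_on_mult continuous_on_const continuous_on_avg cD)
    fix x
    have "avg b (\<lambda>x. F x * ln (G x / H x)) x \<le> 1 / (4 * a) * avg b (\<lambda>x. (grad F x \<bullet> b)\<^sup>2 / F x) x"
      unfolding H_def
      using avg_ln_le[OF C1(2) F(2) G(1,2) b, of x] avg_log_sobolev[OF F b, of x] by linarith
    then show "avg b (\<lambda>x. F x * ln (G x / H x)) x * W x
        \<le> 1 / (4 * a) * avg b (\<lambda>x. (grad F x \<bullet> b)\<^sup>2 / F x) x * W x"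
      by (intro mult_right_mono) (simp_all add: box_weight_def)
  qed
  also have "\<dots> = 1 / (4 * a) * (\<integral>x. (grad F x \<bullet> b)\<^sup>2 / F x * W x \<partial>lborel)"
    unfolding mult.assoc integral_avg[OF cD b, symmetric] by simp
  finally have "(\<integral>x. F x * ln (F x) * W x \<partial>lborel) - (\<integral>x. F x * ln (H x) * W x \<partial>lborel)
      \<le> 1 / (4 * a) * (\<Sum>b\<in>insert b S. \<integral>x. (grad F x \<bullet> b)\<^sup>2 / F x * W x \<partial>lborel)"
    using G(5) insert.hyps by (simp add: distrib_left)
  then show ?case using H indep mass by (intro exI[of _ H]) auto
qed

lemma box_weight_integral_pos: "0 < (\<integral>(x::'a::euclidean_space). W x \<partial>lborel)"
proof -
  have c: "continuous_on (centered_cube R) (\<lambda>x::'a. exp (- a * (norm x)\<^sup>2))"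
    by (intro continuous_intros)
  have "0 < integral (centered_cube R) (\<lambda>x::'a. exp (- a * (norm x)\<^sup>2))"
    using R by (intro integral_cbox_pos box_centered_cube_nonempty c) auto
  then show ?thesis using integral_indicator_cbox(1)[OF c] by (simp add: box_weight_def)
qed

text \<open>
  Averaged over all directions, \<open>F\<close> becomes the constant \<open>G 0\<close>, its mean with respect to \<open>W\<close>.
\<close>

lemma gaussian_log_sobolev_box:
  fixes F :: "'a::euclidean_space \<Rightarrow> real"
  assumes F: "C_class 1 F" "\<And>x. 0 < F x"
  shows "(\<integral>x. F x * ln (F x) * W x \<partial>lborel)
      - (\<integral>x. F x * W x \<partial>lborel) * ln ((\<integral>x. F x * W x \<partial>lborel) / (\<integral>(x::'a). W x \<partial>lborel))
    \<le> 1 / (4 * a) * (\<integral>x. (norm (grad F x))\<^sup>2 / F x * W x \<partial>lborel)"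
proof -
  note C1 = C_class_1D[OF F(1)]
  obtain G where G: "\<forall>x. 0 < G x" "\<forall>b\<in>Basis. \<forall>x s. G (x + s *\<^sub>R b) = G x"
     "(\<integral>x. G x * W x \<partial>lborel) = (\<integral>x. F x * W x \<partial>lborel)"
     "(\<integral>x. F x * ln (F x) * W x \<partial>lborel) - (\<integral>x. F x * ln (G x) * W x \<partial>lborel)
       \<le> 1 / (4 * a) * (\<Sum>b\<in>Basis. \<integral>x. (grad F x \<bullet> b)\<^sup>2 / F x * W x \<partial>lborel)"
    using entropy_telescope[OF F finite_Basis subset_refl] by blast
  have const: "G x = G 0" for x
  proof -
    have "G (\<Sum>b\<in>S. (x \<bullet> b) *\<^sub>R b) = G 0" if "finite S" "S \<subseteq> Basis" for S
      using that
    proof (induction S rule: finite_induct)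
      case (insert c S)
      have "G ((\<Sum>b\<in>S. (x \<bullet> b) *\<^sub>R b) + (x \<bullet> c) *\<^sub>R c) = G (\<Sum>b\<in>S. (x \<bullet> b) *\<^sub>R b)"
        using G(2) insert.prems by blast
      with insert show ?case by (simp add: add.commute)
    qed simp
    from this[OF finite_Basis subset_refl] show ?thesis by (simp add: euclidean_representation)
  qed
  have N: "0 < (\<integral>(x::'a). W x \<partial>lborel)" by (rule box_weight_integral_pos)
  have "(\<integral>x. F x * W x \<partial>lborel) = G 0 * (\<integral>(x::'a). W x \<partial>lborel)"
    unfolding G(3)[symmetric] by (subst const) simp
  then have G0: "G 0 = (\<integral>x. F x * W x \<partial>lborel) / (\<integral>(x::'a). W x \<partial>lborel)"
    using N by simp
  have "(\<integral>x. F x * ln (G x) * W x \<partial>lborel) = (\<integral>x. ln (G 0) * (F x * W x) \<partial>lborel)"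
    by (subst const) (simp add: mult_ac)
  then have 1: "(\<integral>x. F x * ln (G x) * W x \<partial>lborel) = (\<integral>x. F x * W x \<partial>lborel) * ln (G 0)"
    by simp
  have cD: "continuous_on UNIV (\<lambda>x. (grad F x \<bullet> b)\<^sup>2 / F x)" for b
    using F(2) by (auto intro!: continuous_intros C1 simp: less_imp_neq[symmetric])
  have "(norm (grad F x))\<^sup>2 = (\<Sum>b\<in>Basis. (grad F x \<bullet> b)\<^sup>2)" for x
    unfolding power2_norm_eq_inner by (subst euclidean_inner) (simp add: power2_eq_square)
  then have "(\<integral>x. (norm (grad F x))\<^sup>2 / F x * W x \<partial>lborel)
      = (\<integral>x. (\<Sum>b\<in>Basis. (grad F x \<bullet> b)\<^sup>2 / F x * W x) \<partial>lborel)"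
    by (simp add: sum_divide_distrib sum_distrib_right)
  also have "\<dots> = (\<Sum>b\<in>Basis. \<integral>x. (grad F x \<bullet> b)\<^sup>2 / F x * W x \<partial>lborel)"
    by (intro Bochner_Integration.integral_sum integrable_box_weight cD)
  finally show ?thesis using G(4) 1 G0 by simp
qed

end

section \<open>Perturbation and linearization on a box\<close>

text \<open>
  The weight \<open>\<rho>\<close> need not have mass 1 on \<open>B\<close>; dividing by its mass inside the logarithm makes the
  functional homogeneous of degree 1 in both \<open>\<rho>\<close> and \<open>F\<close>.
\<close>

definition entropy_on :: "'a::euclidean_space set \<Rightarrow> ('a \<Rightarrow> real) \<Rightarrow> ('a \<Rightarrow> real) \<Rightarrow> real" where
  "entropy_on B \<rho> F = integral B (\<lambda>x. F x * ln (F x) * \<rho> x)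
     - integral B (\<lambda>x. F x * \<rho> x) * ln (integral B (\<lambda>x. F x * \<rho> x) / integral B \<rho>)"

text \<open>
  Entropy is a minimum over \<open>t > 0\<close> of integrals of the nonnegative function
  \<open>F ln F - F ln t - F + t\<close>, the minimizer being the mean of \<open>F\<close>.  With \<open>t\<close> the mean for \<open>\<gamma>\<close>, nonnegativity
  allows to pass from \<open>\<rho>\<close> to \<open>\<gamma>\<close> on the left, and \<open>D \<ge> 0\<close> to pass back on the right.
\<close>

lemma holley_stroock_perturbation:
  fixes \<gamma> \<rho> F D :: "'a::euclidean_space \<Rightarrow> real" and l u :: 'a
  defines "B \<equiv> cbox l u"
  assumes B: "box l u \<noteq> {}"
    and c\<gamma>: "continuous_on B \<gamma>" and c\<rho>: "continuous_on B \<rho>"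
    and c1: "0 < c1" and \<gamma>: "\<And>x. 0 < \<gamma> x"
    and comp: "\<And>x. c1 * \<gamma> x \<le> \<rho> x" "\<And>x. \<rho> x \<le> c2 * \<gamma> x"
    and F: "continuous_on B F" "\<And>x. 0 < F x"
    and D: "continuous_on B D" "\<And>x. 0 \<le> D x"
    and c: "0 \<le> c" and lsi: "entropy_on B \<gamma> F \<le> c * integral B (\<lambda>x. D x * \<gamma> x)"
  shows "entropy_on B \<rho> F \<le> c2 / c1 * c * integral B (\<lambda>x. D x * \<rho> x)"
proof -
  have \<rho>: "0 < \<rho> x" for x using comp(1)[of x] c1 \<gamma>[of x] by (meson less_le_trans mult_pos_pos)
  have c2: "0 < c2"
    using comp(2)[of undefined] \<rho>[of undefined] \<gamma>[of undefined]
    by (meson less_le_trans zero_less_mult_pos2)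
  have cFl: "continuous_on B (\<lambda>x. F x * ln (F x))"
    using F by (intro continuous_intros) (auto simp: less_imp_neq[symmetric])
  define N N' where "N = integral B \<gamma>" and "N' = integral B \<rho>"
  define M M' where "M = integral B (\<lambda>x. F x * \<gamma> x)" and "M' = integral B (\<lambda>x. F x * \<rho> x)"
  have pos: "0 < N" "0 < N'" "0 < M" "0 < M'"
    unfolding N_def N'_def M_def M'_def B_def
    using B c\<gamma> c\<rho> F \<gamma> \<rho> by (auto simp: B_def intro!: integral_cbox_pos continuous_intros)
  define t where "t = M / N"
  have t: "0 < t" using pos by (simp add: t_def)
  define e where "e = (\<lambda>x. F x * ln (F x) - F x * ln t - F x + t)"
  have e: "0 \<le> e x" for x
  proof -
    have "ln (t / F x) \<le> t / F x - 1" using F(2)[of x] t by (intro ln_le_minus_one) auto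
    then have "F x * (ln t - ln (F x)) \<le> F x * (t / F x - 1)"
      using F(2)[of x] t by (intro mult_left_mono) (auto simp: ln_div)
    then show ?thesis using F(2)[of x] by (simp add: e_def algebra_simps)
  qed
  have ce: "continuous_on B e" unfolding e_def by (intro continuous_intros cFl F(1))
  have int_e: "integral B (\<lambda>x. e x * \<sigma> x) = integral B (\<lambda>x. F x * ln (F x) * \<sigma> x)
      - ln t * integral B (\<lambda>x. F x * \<sigma> x) - integral B (\<lambda>x. F x * \<sigma> x) + t * integral B \<sigma>"
    if \<sigma>: "continuous_on B \<sigma>" for \<sigma>
  proof -
    have i1: "(\<lambda>x. F x * ln (F x) * \<sigma> x) integrable_on B"
      and i2: "(\<lambda>x. F x * \<sigma> x) integrable_on B" and i3: "\<sigma> integrable_on B"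
      unfolding B_def using cFl F(1) \<sigma>
      by (auto simp: B_def intro!: integrable_continuous continuous_on_mult)
    have "(\<lambda>x. e x * \<sigma> x) = (\<lambda>x. F x * ln (F x) * \<sigma> x - ln t * (F x * \<sigma> x) - F x * \<sigma> x + t * \<sigma> x)"
      by (simp add: e_def algebra_simps fun_eq_iff)
    moreover have "((\<lambda>x. F x * ln (F x) * \<sigma> x - ln t * (F x * \<sigma> x) - F x * \<sigma> x + t * \<sigma> x) has_integral
      (integral B (\<lambda>x. F x * ln (F x) * \<sigma> x)
      - ln t * integral B (\<lambda>x. F x * \<sigma> x) - integral B (\<lambda>x. F x * \<sigma> x) + t * integral B \<sigma>)) B"
      by (intro has_integral_add has_integral_diff has_integral_mult_right integrable_integral i1 i2 i3)
    ultimately show ?thesis by (simp add: integral_unique)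
  qed
  have Ent\<gamma>: "integral B (\<lambda>x. e x * \<gamma> x) = entropy_on B \<gamma> F"
    unfolding int_e[OF c\<gamma>] entropy_on_def using pos
    by (simp add: N_def[symmetric] M_def[symmetric] t_def)
  have "entropy_on B \<rho> F \<le> integral B (\<lambda>x. e x * \<rho> x)"
  proof -
    have "ln (t * N' / M') \<le> t * N' / M' - 1" using t pos by (intro ln_le_minus_one) auto
    moreover have "ln (t * N' / M') = ln t - ln (M' / N')"
      using t pos by (simp add: ln_div ln_mult_pos)
    ultimately have "M' * (ln t - ln (M' / N')) \<le> M' * (t * N' / M' - 1)"
      using pos by (intro mult_left_mono) auto
    then have "M' * ln t - M' * ln (M' / N') \<le> t * N' - M'"
      using pos by (simp add: right_diff_distrib)
    then show ?thesis
      unfolding int_e[OF c\<rho>] entropy_on_def N'_def[symmetric] M'_def[symmetric] by (simp add: mult.commute)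
  qed
  also have "\<dots> \<le> integral B (\<lambda>x. c2 * (e x * \<gamma> x))"
  proof (rule integral_le)
    show "(\<lambda>x. e x * \<rho> x) integrable_on B" "(\<lambda>x. c2 * (e x * \<gamma> x)) integrable_on B"
      unfolding B_def using ce c\<gamma> c\<rho> by (auto simp: B_def intro!: integrable_continuous continuous_intros)
    show "e x * \<rho> x \<le> c2 * (e x * \<gamma> x)" for x
      using mult_left_mono[OF comp(2)[of x] e[of x]] by (simp add: mult_ac)
  qed
  also have "\<dots> = c2 * entropy_on B \<gamma> F" by (simp add: Ent\<gamma>)
  also have "\<dots> \<le> c2 * (c * integral B (\<lambda>x. D x * \<gamma> x))"
    using lsi c2 by (intro mult_left_mono) auto
  also have "\<dots> \<le> c2 * (c * integral B (\<lambda>x. 1 / c1 * (D x * \<rho> x)))"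
  proof (intro mult_left_mono integral_le)
    show "(\<lambda>x. D x * \<gamma> x) integrable_on B" "(\<lambda>x. 1 / c1 * (D x * \<rho> x)) integrable_on B"
      unfolding B_def using D c\<gamma> c\<rho> c1 by (auto simp: B_def intro!: integrable_continuous continuous_intros)
    show "D x * \<gamma> x \<le> 1 / c1 * (D x * \<rho> x)" for x
      using mult_left_mono[OF comp(1)[of x] D(2)[of x]] c1 by (simp add: field_simps)
  qed (use c c2 in auto)
  also have "\<dots> = c2 / c1 * c * integral B (\<lambda>x. D x * \<rho> x)"
    unfolding integral_mult_right by simp
  finally show ?thesis .
qed

text \<open>
  Only the point 0 matters; there \<open>\<bar>x ln x\<bar> \<le> 2 sqrt x\<close>, from \<open>ln y \<le> y - 1\<close> at \<open>y = 1 / sqrt x\<close>.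
\<close>

lemma continuous_on_x_ln_x: "continuous_on {0..} (\<lambda>x::real. x * ln x)"
proof -
  have "((\<lambda>x::real. x * ln x) \<longlongrightarrow> 0) (at 0 within {0..})"
  proof (rule Lim_null_comparison)
    show "\<forall>\<^sub>F x in at 0 within {0..}. norm (x * ln x :: real) \<le> 2 * sqrt x"
      unfolding eventually_at
    proof (intro exI[of _ 1] conjI ballI impI)
      fix x :: real assume x: "x \<in> {0..}" "x \<noteq> 0 \<and> dist x 0 < 1"
      then have x': "0 < x" "x < 1" by auto
      define s where "s = sqrt x"
      have s: "0 < s" "s < 1" "x = s\<^sup>2" using x' by (auto simp: s_def)
      have "ln (1 / s) \<le> 1 / s - 1" using s by (intro ln_le_minus_one) auto
      then have "s * - ln s \<le> s * (1 / s - 1)" using s by (intro mult_left_mono) (auto simp: ln_div)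
      then have "s * - ln s \<le> 1" using s by (simp add: right_diff_distrib)
      then have "s * (s * - ln s) \<le> s * 1" using s by (intro mult_left_mono) auto
      moreover have "\<bar>x * ln x\<bar> = 2 * (s * (s * - ln s))"
      proof -
        have "ln x = 2 * ln s" using s by (simp add: ln_realpow)
        moreover have "ln s < 0" using s by simp
        ultimately show ?thesis using s by (simp add: abs_mult power2_eq_square)
      qed
      ultimately show "norm (x * ln x) \<le> 2 * sqrt x" by (simp add: s_def)
    qed simp
    have "((\<lambda>x. 2 * sqrt x) \<longlongrightarrow> 2 * sqrt 0) (at 0 within {0..})" by (intro tendsto_intros)
    then show "((\<lambda>x. 2 * sqrt x) \<longlongrightarrow> 0) (at 0 within {0..})" by simp
  qed
  then have 0: "continuous (at 0 within {0..}) (\<lambda>x::real. x * ln x)"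
    by (simp add: continuous_within)
  show ?thesis unfolding continuous_on_eq_continuous_within
  proof
    fix x :: real assume "x \<in> {0..}"
    show "continuous (at x within {0..}) (\<lambda>x. x * ln x)"
    proof (cases "x = 0")
      case False
      then show ?thesis by (intro continuous_intros) auto
    qed (use 0 in simp)
  qed
qed

text \<open>
  Apply the inequality for positive functions to \<open>f\<^sup>2 + \<epsilon>\<close>, for which \<open>\<bar>\<nabla>F\<bar>\<^sup>2 / F \<le> 4 \<bar>\<nabla>f\<bar>\<^sup>2\<close>, and let \<open>\<epsilon>\<close>
  tend to 0.  Everything is continuous up to \<open>\<epsilon> = 0\<close> because \<open>x ln x\<close> is.
\<close>

lemma log_sobolev_of_squares:
  fixes \<rho> f :: "'a::euclidean_space \<Rightarrow> real" and l u :: 'a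
  defines "B \<equiv> cbox l u"
  assumes B: "box l u \<noteq> {}"
    and c\<rho>: "continuous_on UNIV \<rho>" and \<rho>: "\<And>x. 0 < \<rho> x"
    and f: "C_class 1 f" and c: "0 \<le> c"
    and lsi: "\<And>F. C_class 1 F \<Longrightarrow> (\<And>x. 0 < F x) \<Longrightarrow>
       entropy_on B \<rho> F \<le> c * integral B (\<lambda>x. (norm (grad F x))\<^sup>2 / F x * \<rho> x)"
  shows "entropy_on B \<rho> (\<lambda>x. (f x)\<^sup>2) \<le> 4 * c * integral B (\<lambda>x. (norm (grad f x))\<^sup>2 * \<rho> x)"
proof -
  note C1 = C_class_1D[OF f]
  define \<psi> where "\<psi> = (\<lambda>x::real. x * ln x)"
  define N where "N = integral B \<rho>"
  have N: "0 < N" unfolding N_def B_def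
    by (intro integral_cbox_pos B \<rho> continuous_on_subset[OF c\<rho>]) simp
  define J where "J = (\<lambda>\<epsilon>. integral B (\<lambda>x. \<psi> ((f x)\<^sup>2 + \<epsilon>) * \<rho> x))"
  define M where "M = (\<lambda>\<epsilon>. integral B (\<lambda>x. ((f x)\<^sup>2 + \<epsilon>) * \<rho> x))"
  have ent: "entropy_on B \<rho> (\<lambda>x. (f x)\<^sup>2 + \<epsilon>) = J \<epsilon> - N * \<psi> (M \<epsilon> / N)" for \<epsilon>
    using N by (simp add: entropy_on_def J_def M_def \<psi>_def N_def[symmetric])
  have cJ: "continuous_on {0..1} J"
    unfolding J_def B_def
  proof (rule integral_continuous_on_param)
    show "continuous_on ({0..1} \<times> cbox l u) (\<lambda>(\<epsilon>, x). \<psi> ((f x)\<^sup>2 + \<epsilon>) * \<rho> x)"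
      unfolding split_beta \<psi>_def
      by (intro continuous_on_mult continuous_on_compose2[OF continuous_on_x_ln_x]
          continuous_on_compose2[OF c\<rho>] continuous_on_add continuous_on_power
          continuous_on_compose2[OF C1(2)] continuous_intros) auto
  qed
  have cM: "continuous_on {0..1} M"
    unfolding M_def B_def
  proof (rule integral_continuous_on_param)
    show "continuous_on ({0..1} \<times> cbox l u) (\<lambda>(\<epsilon>, x). ((f x)\<^sup>2 + \<epsilon>) * \<rho> x)"
      unfolding split_beta
      by (intro continuous_on_mult continuous_on_compose2[OF c\<rho>] continuous_on_add continuous_on_power
          continuous_on_compose2[OF C1(2)] continuous_intros) auto
  qed
  have M0: "0 \<le> M \<epsilon>" if "0 \<le> \<epsilon>" for \<epsilon>
    unfolding M_def B_def using that \<rho>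
    by (intro integral_nonneg integrable_continuous continuous_intros
        continuous_on_subset[OF c\<rho>] continuous_on_subset[OF C1(2)]) (auto simp: less_imp_le)
  have c\<psi>: "continuous_on {0..} \<psi>" unfolding \<psi>_def by (rule continuous_on_x_ln_x)
  have cMN: "continuous_on {0..1} (\<lambda>\<epsilon>. M \<epsilon> / N)"
    using N by (intro continuous_on_divide cM continuous_on_const) auto
  have "continuous_on {0..1} (\<lambda>\<epsilon>. \<psi> (M \<epsilon> / N))"
  proof (rule continuous_on_compose2[OF c\<psi> cMN], rule image_subsetI)
    fix \<epsilon> :: real assume "\<epsilon> \<in> {0..1}"
    then have "0 \<le> M \<epsilon>" by (intro M0) simp
    then show "M \<epsilon> / N \<in> {0..}" using N by simp
  qed
  then have cE: "continuous_on {0..1} (\<lambda>\<epsilon>. J \<epsilon> - N * \<psi> (M \<epsilon> / N))"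
    by (intro continuous_on_diff continuous_on_mult continuous_on_const cJ)
  have bound: "J \<epsilon> - N * \<psi> (M \<epsilon> / N) \<le> 4 * c * integral B (\<lambda>x. (norm (grad f x))\<^sup>2 * \<rho> x)"
    if \<epsilon>: "0 < \<epsilon>" for \<epsilon>
  proof -
    define F where "F = (\<lambda>x. (f x)\<^sup>2 + \<epsilon>)"
    have Fpos: "0 < F x" for x using \<epsilon> by (simp add: F_def add_nonneg_pos)
    have dF: "(F has_derivative (\<lambda>h. ((2 * f x) *\<^sub>R grad f x) \<bullet> h)) (at x)" for x
      unfolding F_def
      by (rule derivative_eq_intros has_derivative_grad[OF C1(1)] refl)+ (simp add: fun_eq_iff)
    have gF: "grad F x = (2 * f x) *\<^sub>R grad f x" for x by (rule grad_eqI[OF dF])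
    have F1: "C_class 1 F"
      unfolding One_nat_def C_class.simps gF
    proof (intro conjI ballI continuous_on_inner continuous_on_scaleR continuous_on_mult continuous_on_const C1(2,3))
      show "F differentiable_on UNIV"
        using dF by (auto simp: differentiable_on_def differentiable_def)
    qed
    have "J \<epsilon> - N * \<psi> (M \<epsilon> / N) \<le> c * integral B (\<lambda>x. (norm (grad F x))\<^sup>2 / F x * \<rho> x)"
      using lsi[OF F1 Fpos] unfolding F_def ent .
    also have "\<dots> \<le> c * integral B (\<lambda>x. 4 * ((norm (grad f x))\<^sup>2 * \<rho> x))"
    proof (intro mult_left_mono integral_le c)
      have "continuous_on UNIV (\<lambda>x. (norm (grad F x))\<^sup>2 / F x * \<rho> x)"
        using Fpos C_class_1D[OF F1]
        by (intro continuous_on_mult continuous_on_divide continuous_on_power continuous_on_norm c\<rho>)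
           (auto simp: less_imp_neq[symmetric])
      then show "(\<lambda>x. (norm (grad F x))\<^sup>2 / F x * \<rho> x) integrable_on B"
        unfolding B_def by (intro integrable_continuous) (auto intro: continuous_on_subset)
      have "continuous_on UNIV (\<lambda>x. 4 * ((norm (grad f x))\<^sup>2 * \<rho> x))"
        by (intro continuous_intros C1 c\<rho>)
      then show "(\<lambda>x. 4 * ((norm (grad f x))\<^sup>2 * \<rho> x)) integrable_on B"
        unfolding B_def by (intro integrable_continuous) (auto intro: continuous_on_subset)
      fix x
      have "(norm (grad F x))\<^sup>2 / F x = 4 * (norm (grad f x))\<^sup>2 * ((f x)\<^sup>2 / F x)"
        by (simp add: gF power_mult_distrib)
      also have "\<dots> \<le> 4 * (norm (grad f x))\<^sup>2 * 1"
        using Fpos[of x] \<epsilon> by (intro mult_left_mono) (auto simp: F_def)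
      finally have "(norm (grad F x))\<^sup>2 / F x \<le> 4 * (norm (grad f x))\<^sup>2" by simp
      from mult_right_mono[OF this less_imp_le[OF \<rho>[of x]]]
      show "(norm (grad F x))\<^sup>2 / F x * \<rho> x \<le> 4 * ((norm (grad f x))\<^sup>2 * \<rho> x)" by (simp add: mult.assoc)
    qed
    finally show ?thesis by simp
  qed
  have "((\<lambda>\<epsilon>. J \<epsilon> - N * \<psi> (M \<epsilon> / N)) \<longlongrightarrow> J 0 - N * \<psi> (M 0 / N)) (at 0 within {0..1})"
    using cE unfolding continuous_on_def by (auto dest: bspec[of _ _ 0])
  moreover have "at 0 within {0..1} = at_right (0::real)"
    by (rule at_within_Icc_at_right) simp
  ultimately have "((\<lambda>\<epsilon>. J \<epsilon> - N * \<psi> (M \<epsilon> / N)) \<longlongrightarrow> J 0 - N * \<psi> (M 0 / N)) (at_right 0)" by simp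
  then have "J 0 - N * \<psi> (M 0 / N) \<le> 4 * c * integral B (\<lambda>x. (norm (grad f x))\<^sup>2 * \<rho> x)"
    by (rule tendsto_upperbound)
       (auto intro!: bound eventually_mono[OF eventually_at_right_less])
  then show ?thesis using ent[of 0] by simp
qed

text \<open>
  The expansion of \<open>(1 + u)\<^sup>2 ln ((1 + u)\<^sup>2)\<close> to second order, with an explicit cubic remainder.
\<close>

lemma square_ln_square_lower_bound:
  fixes u :: real
  assumes "\<bar>u\<bar> < 1"
  shows "2 * u + 3 * u\<^sup>2 - 4 / 3 * \<bar>u\<bar> ^ 3 \<le> (1 + u)\<^sup>2 * ln ((1 + u)\<^sup>2)"
proof -
  define \<phi> where "\<phi> = (\<lambda>u::real. 2 * (1 + u)\<^sup>2 * ln (1 + u) - 2 * u - 3 * u\<^sup>2)"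
  have d\<phi>: "(\<phi> has_real_derivative 4 * ((1 + y) * ln (1 + y) - y)) (at y)" if "-1 < y" for y :: real
  proof -
    have "(\<phi> has_real_derivative 4 * (1 + y) * ln (1 + y) + 2 * ((1 + y) * ((1 + y) / (1 + y))) - 2 - 6 * y) (at y)"
      unfolding \<phi>_def using that
      by (auto intro!: derivative_eq_intros simp: power2_eq_square)
    then show ?thesis using that by (simp add: algebra_simps)
  qed
  have lo: "y \<le> (1 + y) * ln (1 + y)" if "-1 < y" for y :: real
  proof -
    have "ln (1 / (1 + y)) \<le> 1 / (1 + y) - 1" using that by (intro ln_le_minus_one) auto
    then have "(1 + y) * - ln (1 + y) \<le> (1 + y) * (1 / (1 + y) - 1)"
      using that by (intro mult_left_mono) (auto simp: ln_div)
    then show ?thesis using that by (simp add: right_diff_distrib)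
  qed
  have hi: "(1 + y) * ln (1 + y) \<le> y + y\<^sup>2" if "-1 < y" for y :: real
  proof -
    have "ln (1 + y) \<le> y" using ln_le_minus_one[of "1 + y"] that by simp
    then have "(1 + y) * ln (1 + y) \<le> (1 + y) * y" using that by (intro mult_left_mono) auto
    then show ?thesis by (simp add: algebra_simps power2_eq_square)
  qed
  have "- 4 / 3 * \<bar>u\<bar> ^ 3 \<le> \<phi> u"
  proof (cases "0 \<le> u")
    case True
    have "\<phi> 0 \<le> \<phi> u"
    proof (rule DERIV_nonneg_imp_nondecreasing[OF True])
      fix y :: real assume "0 \<le> y" "y \<le> u"
      then show "\<exists>D. DERIV \<phi> y :> D \<and> 0 \<le> D" using d\<phi>[of y] lo[of y]
        by (intro exI[of _ "4 * ((1 + y) * ln (1 + y) - y)"] conjI) auto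
    qed
    moreover have "0 \<le> \<bar>u\<bar> ^ 3" by simp
    moreover have "\<phi> 0 = 0" by (simp add: \<phi>_def)
    ultimately show ?thesis by linarith
  next
    case False
    define \<eta> where "\<eta> = (\<lambda>u. \<phi> u - 4 / 3 * u ^ 3)"
    have "\<eta> 0 \<le> \<eta> u"
    proof (rule DERIV_nonpos_imp_nonincreasing[of u 0])
      fix y :: real assume y: "u \<le> y" "y \<le> 0"
      have "DERIV \<eta> y :> 4 * ((1 + y) * ln (1 + y) - y) - 4 * y\<^sup>2"
        unfolding \<eta>_def using y assms
        by (auto intro!: derivative_eq_intros d\<phi>)
      then show "\<exists>D. DERIV \<eta> y :> D \<and> D \<le> 0" using hi[of y] y assms
        by (intro exI[of _ "4 * ((1 + y) * ln (1 + y) - y) - 4 * y\<^sup>2"] conjI) auto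
    qed (use False in simp)
    then show ?thesis using False by (simp add: \<eta>_def \<phi>_def)
  qed
  moreover have "ln ((1 + u)\<^sup>2) = 2 * ln (1 + u)" using assms by (simp add: ln_realpow)
  ultimately show ?thesis by (simp add: \<phi>_def algebra_simps)
qed

text \<open>
  Insert \<open>f = 1 + \<epsilon> g\<close> with \<open>g\<close> the centered \<open>h\<close>.  The entropy of \<open>f\<^sup>2\<close> is \<open>2 \<epsilon>\<^sup>2 V + O(\<epsilon>\<^sup>3)\<close>, \<open>V\<close> being the variance
  integral, while the right side is \<open>2 C \<epsilon>\<^sup>2 D\<close>.  On a box \<open>g\<close> is bounded, so the expansion is uniform.
\<close>

lemma poincare_of_log_sobolev:
  fixes \<rho> h :: "'a::euclidean_space \<Rightarrow> real" and l u :: 'a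
  defines "B \<equiv> cbox l u"
  assumes B: "box l u \<noteq> {}"
    and c\<rho>: "continuous_on UNIV \<rho>" and \<rho>: "\<And>x. 0 < \<rho> x"
    and h: "C_class 1 h"
    and lsi: "\<And>f. C_class 1 f \<Longrightarrow>
       entropy_on B \<rho> (\<lambda>x. (f x)\<^sup>2) \<le> 2 * C * integral B (\<lambda>x. (norm (grad f x))\<^sup>2 * \<rho> x)"
  shows "integral B (\<lambda>x. (h x)\<^sup>2 * \<rho> x) - (integral B (\<lambda>x. h x * \<rho> x))\<^sup>2 / integral B \<rho>
      \<le> C * integral B (\<lambda>x. (norm (grad h x))\<^sup>2 * \<rho> x)"
proof -
  note C1 = C_class_1D[OF h]
  define N where "N = integral B \<rho>"
  have N: "0 < N" unfolding N_def B_def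
    by (intro integral_cbox_pos B \<rho> continuous_on_subset[OF c\<rho>]) simp
  define m where "m = integral B (\<lambda>x. h x * \<rho> x) / N"
  define g where "g = (\<lambda>x. h x - m)"
  have cg: "continuous_on UNIV g" unfolding g_def by (intro continuous_intros C1(2))
  have int: "(\<lambda>x. p x * \<rho> x) integrable_on B" if "continuous_on UNIV p" for p
    unfolding B_def
    by (intro integrable_continuous continuous_on_subset[OF continuous_on_mult[OF that c\<rho>]]) simp
  have i0: "\<rho> integrable_on B" using int[of "\<lambda>_. 1"] by simp
  have i2: "(\<lambda>x. (g x)\<^sup>2 * \<rho> x) integrable_on B" by (intro int continuous_intros cg)
  have ih: "(\<lambda>x. h x * \<rho> x) integrable_on B" by (intro int C1(2))
  define V where "V = integral B (\<lambda>x. (g x)\<^sup>2 * \<rho> x)"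
  define D where "D = integral B (\<lambda>x. (norm (grad h x))\<^sup>2 * \<rho> x)"
  \<comment> \<open>As \<open>g\<close> has mean 0, the linear term drops out.\<close>
  have lin: "integral B (\<lambda>x. (p + q * g x + r * (g x)\<^sup>2) * \<rho> x) = p * N + r * V" for p q r
  proof -
    have "((\<lambda>x. h x * \<rho> x - m * \<rho> x) has_integral (integral B (\<lambda>x. h x * \<rho> x) - m * N)) B"
      unfolding N_def by (intro has_integral_diff has_integral_mult_right integrable_integral ih i0)
    then have g0: "((\<lambda>x. g x * \<rho> x) has_integral 0) B"
      using N by (simp add: g_def left_diff_distrib m_def)
    have "((\<lambda>x. p * \<rho> x + q * (g x * \<rho> x) + r * ((g x)\<^sup>2 * \<rho> x)) has_integral (p * N + q * 0 + r * V)) B"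
      unfolding N_def V_def
      by (intro has_integral_add has_integral_mult_right integrable_integral i0 i2 g0)
    moreover have "(\<lambda>x. p * \<rho> x + q * (g x * \<rho> x) + r * ((g x)\<^sup>2 * \<rho> x))
        = (\<lambda>x. (p + q * g x + r * (g x)\<^sup>2) * \<rho> x)" by (simp add: fun_eq_iff algebra_simps)
    ultimately show ?thesis by (simp add: integral_unique)
  qed
  have V0: "0 \<le> V" unfolding V_def using \<rho> by (intro integral_nonneg i2) (simp add: less_imp_le)
  have "bounded (g ` B)" unfolding B_def
    by (intro compact_imp_bounded compact_continuous_image compact_cbox continuous_on_subset[OF cg]) simp
  then obtain A where A: "0 < A" "\<And>x. x \<in> B \<Longrightarrow> \<bar>g x\<bar> \<le> A"
    unfolding bounded_pos by auto
  have key: "2 * V - 4 / 3 * \<epsilon> * A * V - \<epsilon>\<^sup>2 * V\<^sup>2 / N \<le> 2 * C * D" if \<epsilon>: "0 < \<epsilon>" "\<epsilon> * A < 1" for \<epsilon>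
  proof -
    define f where "f = (\<lambda>x. 1 + \<epsilon> * g x)"
    have df: "(f has_derivative (\<lambda>k. (\<epsilon> *\<^sub>R grad h x) \<bullet> k)) (at x)" for x
      unfolding f_def g_def
      by (rule derivative_eq_intros has_derivative_grad[OF C1(1)] refl)+ simp
    have gf: "grad f x = \<epsilon> *\<^sub>R grad h x" for x by (rule grad_eqI[OF df])
    have f1: "C_class 1 f"
      unfolding One_nat_def C_class.simps gf
    proof (intro conjI ballI continuous_on_inner continuous_on_scaleR continuous_on_const C1(3))
      show "f differentiable_on UNIV"
        using df by (auto simp: differentiable_on_def differentiable_def)
    qed
    have cf: "continuous_on UNIV f" using C_class_1D(2)[OF f1] .
    have f2: "(f x)\<^sup>2 = 1 + 2 * \<epsilon> * g x + \<epsilon>\<^sup>2 * (g x)\<^sup>2" for x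
      by (simp add: f_def power2_eq_square algebra_simps)
    have M: "integral B (\<lambda>x. (f x)\<^sup>2 * \<rho> x) = N + \<epsilon>\<^sup>2 * V"
      unfolding f2 lin by simp
    have "(3 * \<epsilon>\<^sup>2 - 4 / 3 * \<epsilon> ^ 3 * A) * V
        = integral B (\<lambda>x. (0 + 2 * \<epsilon> * g x + (3 * \<epsilon>\<^sup>2 - 4 / 3 * \<epsilon> ^ 3 * A) * (g x)\<^sup>2) * \<rho> x)"
      unfolding lin by simp
    also have "\<dots> \<le> integral B (\<lambda>x. (f x)\<^sup>2 * ln ((f x)\<^sup>2) * \<rho> x)"
    proof (rule integral_le)
      show "(\<lambda>x. (0 + 2 * \<epsilon> * g x + (3 * \<epsilon>\<^sup>2 - 4 / 3 * \<epsilon> ^ 3 * A) * (g x)\<^sup>2) * \<rho> x) integrable_on B"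
        by (intro int continuous_intros cg)
      have "continuous_on UNIV (\<lambda>x. (f x)\<^sup>2 * ln ((f x)\<^sup>2))"
        by (rule continuous_on_compose2[OF continuous_on_x_ln_x]) (auto intro: continuous_on_power cf)
      then show "(\<lambda>x. (f x)\<^sup>2 * ln ((f x)\<^sup>2) * \<rho> x) integrable_on B" by (rule int)
      fix x assume x: "x \<in> B"
      define y where "y = \<epsilon> * g x"
      have gA: "\<bar>g x\<bar> \<le> A" using A(2)[OF x] .
      have "\<bar>y\<bar> \<le> \<epsilon> * A" using gA \<epsilon> by (simp add: y_def abs_mult)
      then have y: "\<bar>y\<bar> < 1" using \<epsilon> by simp
      have "\<bar>y\<bar> ^ 3 = \<epsilon> ^ 3 * \<bar>g x\<bar> * (g x)\<^sup>2"
        using \<epsilon> by (simp add: y_def abs_mult power_mult_distrib power3_eq_cube power2_eq_square)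
      also have "\<dots> \<le> \<epsilon> ^ 3 * A * (g x)\<^sup>2"
        using gA \<epsilon> by (intro mult_right_mono mult_left_mono) auto
      finally have "2 * y + 3 * y\<^sup>2 - 4 / 3 * (\<epsilon> ^ 3 * A * (g x)\<^sup>2) \<le> (f x)\<^sup>2 * ln ((f x)\<^sup>2)"
        using square_ln_square_lower_bound[OF y] by (simp add: f_def y_def)
      then have "0 + 2 * \<epsilon> * g x + (3 * \<epsilon>\<^sup>2 - 4 / 3 * \<epsilon> ^ 3 * A) * (g x)\<^sup>2 \<le> (f x)\<^sup>2 * ln ((f x)\<^sup>2)"
        by (simp add: y_def algebra_simps)
      then show "(0 + 2 * \<epsilon> * g x + (3 * \<epsilon>\<^sup>2 - 4 / 3 * \<epsilon> ^ 3 * A) * (g x)\<^sup>2) * \<rho> x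
          \<le> (f x)\<^sup>2 * ln ((f x)\<^sup>2) * \<rho> x"
        using \<rho>[of x] by (intro mult_right_mono) auto
    qed
    also have "\<dots> \<le> 2 * C * integral B (\<lambda>x. (norm (grad f x))\<^sup>2 * \<rho> x)
        + (N + \<epsilon>\<^sup>2 * V) * ln ((N + \<epsilon>\<^sup>2 * V) / N)"
      using lsi[OF f1] by (simp add: entropy_on_def M N_def[symmetric])
    also have "(\<lambda>x. (norm (grad f x))\<^sup>2 * \<rho> x) = (\<lambda>x. \<epsilon>\<^sup>2 * ((norm (grad h x))\<^sup>2 * \<rho> x))"
      by (simp add: gf power_mult_distrib fun_eq_iff)
    also have "integral B \<dots> = \<epsilon>\<^sup>2 * D" by (simp add: D_def)
    also have "(N + \<epsilon>\<^sup>2 * V) * ln ((N + \<epsilon>\<^sup>2 * V) / N) \<le> (N + \<epsilon>\<^sup>2 * V) * ((N + \<epsilon>\<^sup>2 * V) / N - 1)"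
      using N V0 by (intro mult_left_mono ln_le_minus_one divide_pos_pos add_pos_nonneg) auto
    also have "\<dots> = \<epsilon>\<^sup>2 * V + \<epsilon>\<^sup>2 * (\<epsilon>\<^sup>2 * V\<^sup>2 / N)"
      using N by (simp add: field_simps power2_eq_square)
    finally have "\<epsilon>\<^sup>2 * (2 * V - 4 / 3 * \<epsilon> * A * V - \<epsilon>\<^sup>2 * V\<^sup>2 / N) \<le> \<epsilon>\<^sup>2 * (2 * C * D)"
      by (simp add: algebra_simps power3_eq_cube power2_eq_square)
    then show ?thesis using \<epsilon> by (simp only: mult_le_cancel_left_pos zero_less_power)
  qed
  have "((\<lambda>\<epsilon>. 2 * V - 4 / 3 * \<epsilon> * A * V - \<epsilon>\<^sup>2 * V\<^sup>2 / N) \<longlongrightarrow> 2 * V - 4 / 3 * 0 * A * V - 0\<^sup>2 * V\<^sup>2 / N) (at_right 0)"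
    using N by (intro tendsto_intros) auto
  then have "2 * V - 4 / 3 * 0 * A * V - 0\<^sup>2 * V\<^sup>2 / N \<le> 2 * C * D"
  proof (rule tendsto_upperbound)
    have "\<forall>\<^sub>F \<epsilon> in at_right 0. 0 < \<epsilon> \<and> \<epsilon> < 1 / A"
      using A(1) by (auto intro!: eventually_conj eventually_at_right_less eventually_at_rightI[of 0 "1 / A"])
    then show "\<forall>\<^sub>F \<epsilon> in at_right 0. 2 * V - 4 / 3 * \<epsilon> * A * V - \<epsilon>\<^sup>2 * V\<^sup>2 / N \<le> 2 * C * D"
    proof eventually_elim
      case (elim \<epsilon>)
      then have "\<epsilon> * A < 1" using A(1) by (simp add: field_simps)
      with elim show ?case by (intro key) auto
    qed
  qed simp
  then have VD: "V \<le> C * D" by simp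
  have "integral B (\<lambda>x. (h x)\<^sup>2 * \<rho> x) = integral B (\<lambda>x. (m\<^sup>2 + 2 * m * g x + 1 * (g x)\<^sup>2) * \<rho> x)"
    by (simp add: g_def power2_eq_square algebra_simps)
  also have "\<dots> = m\<^sup>2 * N + V" unfolding lin by simp
  also have "m\<^sup>2 * N = (integral B (\<lambda>x. h x * \<rho> x))\<^sup>2 / N"
    using N by (simp add: m_def power2_eq_square)
  finally show ?thesis using VD by (simp add: D_def N_def)
qed

section \<open>Exhaustion by cubes\<close>

abbreviation cube :: "nat \<Rightarrow> 'a::euclidean_space set" where
  "cube n \<equiv> centered_cube (real (Suc n))"

lemma eventually_in_cube: "\<forall>\<^sub>F n in sequentially. (x::'a::euclidean_space) \<in> cube n"
proof -
  obtain n0 where n0: "norm x \<le> real n0" using real_arch_simple by blast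
  show ?thesis
  proof (rule eventually_sequentiallyI[of n0])
    fix n assume n: "n0 \<le> n"
    have "\<bar>x \<bullet> b\<bar> \<le> real (Suc n)" if "b \<in> Basis" for b
      using Basis_le_norm[OF that, of x] n0 n by simp
    then have "- real (Suc n) \<le> x \<bullet> b \<and> x \<bullet> b \<le> real (Suc n)" if "b \<in> Basis" for b
      using that by (meson abs_le_D1 abs_le_D2 minus_le_iff)
    then show "x \<in> cube n" unfolding mem_centered_cube by blast
  qed
qed

lemma cube_mono: "m \<le> n \<Longrightarrow> cube m \<subseteq> (cube n :: 'a::euclidean_space set)"
  unfolding subset_iff mem_centered_cube by fastforce

lemma integral_cube_tendsto:
  fixes g :: "'a::euclidean_space \<Rightarrow> real"
  assumes "integrable lborel g" "continuous_on UNIV g"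
  shows "(\<lambda>n. integral (cube n) g) \<longlonglongrightarrow> (\<integral>x. g x \<partial>lborel)"
proof -
  have "(\<lambda>n. \<integral>x. indicator (cube n) x * g x \<partial>lborel) \<longlonglongrightarrow> (\<integral>x. g x \<partial>lborel)"
  proof (rule integral_dominated_convergence[where w = "\<lambda>x. \<bar>g x\<bar>"])
    show "AE x in lborel. (\<lambda>n. indicator (cube n) x * g x) \<longlonglongrightarrow> g x"
    proof (rule AE_I2)
      fix x :: 'a
      have "\<forall>\<^sub>F n in sequentially. indicator (cube n) x * g x = g x"
        using eventually_in_cube[of x] by eventually_elim simp
      then show "(\<lambda>n. indicator (cube n) x * g x) \<longlonglongrightarrow> g x" by (rule tendsto_eventually)
    qed
  qed (use assms in \<open>auto simp: indicator_def\<close>)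
  moreover have "(\<integral>x. indicator (cube n) x * g x \<partial>lborel) = integral (cube n) g" for n
    using assms(2) by (intro integral_indicator_cbox) (auto intro: continuous_on_subset)
  ultimately show ?thesis by simp
qed

text \<open>
  Monotone convergence: the integrals over the cubes increase and stay below a convergent sequence.
\<close>

lemma integrable_of_bounded_cube_integrals:
  fixes g :: "'a::euclidean_space \<Rightarrow> real"
  assumes g: "continuous_on UNIV g" "\<And>x. 0 \<le> g x"
    and r: "\<And>n. integral (cube n) g \<le> r n" "r \<longlonglongrightarrow> L"
  shows "integrable lborel g"
proof -
  have eq: "(\<integral>x. indicator (cube n) x * g x \<partial>lborel) = integral (cube n) g"
    and i: "integrable lborel (\<lambda>x. indicator (cube n) x * g x)" for n
    using integral_indicator_cbox[OF continuous_on_subset[OF g(1) subset_UNIV]] by blast+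
  have mono: "indicator (cube m) x * g x \<le> indicator (cube n) x * g x" if "m \<le> n" for m n x
    using cube_mono[OF that] g(2)[of x] by (auto simp: indicator_def)
  have inc: "incseq (\<lambda>n. integral (cube n) g)"
    unfolding eq[symmetric] by (intro incseq_SucI integral_mono i mono) simp
  obtain K where K: "\<And>n. norm (r n) \<le> K"
    using r(2) convergent_imp_Bseq[of r] by (auto simp: convergent_def Bseq_def)
  have "integral (cube n) g \<le> K" for n using r(1)[of n] K[of n] by simp
  then obtain S where S: "(\<lambda>n. integral (cube n) g) \<longlonglongrightarrow> S"
    using incseq_convergent[OF inc, of K] by blast
  show ?thesis
  proof (rule integrable_monotone_convergence[where f = "\<lambda>n x. indicator (cube n) x * g x" and x = S])
    show "AE x in lborel. mono (\<lambda>n. indicator (cube n) x * g x)"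
      by (intro AE_I2 monoI mono)
    show "AE x in lborel. (\<lambda>n. indicator (cube n) x * g x) \<longlonglongrightarrow> g x"
    proof (rule AE_I2)
      fix x :: 'a
      have "\<forall>\<^sub>F n in sequentially. indicator (cube n) x * g x = g x"
        using eventually_in_cube[of x] by eventually_elim simp
      then show "(\<lambda>n. indicator (cube n) x * g x) \<longlonglongrightarrow> g x" by (rule tendsto_eventually)
    qed
    show "(\<lambda>n. \<integral>x. indicator (cube n) x * g x \<partial>lborel) \<longlonglongrightarrow> S" unfolding eq by (rule S)
    show "g \<in> borel_measurable lborel" using borel_measurable_continuous_onI[OF g(1)] by simp
  qed (rule i)
qed

lemma gaussian_log_sobolev_cube:
  fixes F :: "'a::euclidean_space \<Rightarrow> real"
  assumes a: "0 < a" and F: "C_class 1 F" "\<And>x. 0 < F x"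
  shows "entropy_on (cube n) (\<lambda>x. exp (- a * (norm x)\<^sup>2)) F
     \<le> 1 / (4 * a) * integral (cube n) (\<lambda>x. (norm (grad F x))\<^sup>2 / F x * exp (- a * (norm x)\<^sup>2))"
proof -
  define R where "R = real (Suc n)"
  interpret gaussian_box a R "segment_weight a R" "integral {-R..R} (\<lambda>t. exp (- a * t\<^sup>2))"
    using a by unfold_locales (auto simp: R_def)
  note C1 = C_class_1D[OF F(1)]
  have W: "(\<integral>x. p x * W x \<partial>lborel) = integral (cube n) (\<lambda>x. p x * exp (- a * (norm x)\<^sup>2))"
    if "continuous_on UNIV p" for p :: "'a \<Rightarrow> real"
  proof -
    have "continuous_on UNIV (\<lambda>x. p x * exp (- a * (norm x)\<^sup>2))"
      by (intro continuous_intros that)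
    then have "continuous_on (cube n) (\<lambda>x. p x * exp (- a * (norm x)\<^sup>2))"
      by (rule continuous_on_subset) simp
    from integral_indicator_cbox(1)[OF this] show ?thesis
      by (simp add: box_weight_def R_def mult_ac)
  qed
  have W1: "(\<integral>(x::'a). W x \<partial>lborel) = integral (cube n) (\<lambda>x::'a. exp (- a * (norm x)\<^sup>2))"
    using W[of "\<lambda>_. 1"] by simp
  have c1: "continuous_on UNIV (\<lambda>x. F x * ln (F x))"
    and c2: "continuous_on UNIV (\<lambda>x. (norm (grad F x))\<^sup>2 / F x)"
    using F(2) by (auto intro!: continuous_intros C1 simp: less_imp_neq[symmetric])
  show ?thesis
    using gaussian_log_sobolev_box[OF F] unfolding entropy_on_def W[OF c1] W[OF c2] W[OF C1(2)] W1 .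
qed

text \<open>
  Integrability of the entropy density is part of the claim.  It holds because \<open>y ln y + 1 \<ge> 0\<close>, and the
  inequalities on the cubes bound the integrals of this nonnegative function times \<open>\<rho>\<close>.
\<close>

lemma log_sobolev_ineq_of_cubes:
  fixes \<rho> :: "'a::euclidean_space \<Rightarrow> real"
  assumes c\<rho>: "continuous_on UNIV \<rho>" and \<rho>: "\<And>x. 0 < \<rho> x" and prob: "prob_density \<rho>"
    and lsi: "\<And>n f. C_class 1 f \<Longrightarrow>
       entropy_on (cube n) \<rho> (\<lambda>x. (f x)\<^sup>2) \<le> 2 * C * integral (cube n) (\<lambda>x. (norm (grad f x))\<^sup>2 * \<rho> x)"
  shows "log_sobolev_ineq \<rho> C"
  unfolding log_sobolev_ineq_def
proof (intro allI impI)
  fix f assume "weighted_C1 \<rho> f"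
  then have f: "C_class 1 f" and if2: "integrable lborel (\<lambda>x. (f x)\<^sup>2 * \<rho> x)"
    and ig2: "integrable lborel (\<lambda>x. (norm (grad f x))\<^sup>2 * \<rho> x)"
    by (auto simp: weighted_C1_def)
  have i\<rho>: "integrable lborel \<rho>" and \<rho>1: "(\<integral>x. \<rho> x \<partial>lborel) = 1"
    using prob by (auto simp: prob_density_def has_bochner_integral_iff)
  note C1 = C_class_1D[OF f]
  have c\<psi>: "continuous_on UNIV (\<lambda>x. (f x)\<^sup>2 * ln ((f x)\<^sup>2))"
    by (rule continuous_on_compose2[OF continuous_on_x_ln_x]) (auto intro: continuous_on_power C1)
  have cfl: "continuous_on UNIV (\<lambda>x. (f x)\<^sup>2 * ln ((f x)\<^sup>2) * \<rho> x)"
    by (intro continuous_on_mult c\<psi> c\<rho>)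
  have cf2: "continuous_on UNIV (\<lambda>x. (f x)\<^sup>2 * \<rho> x)" by (intro continuous_intros C1 c\<rho>)
  have cg2: "continuous_on UNIV (\<lambda>x. (norm (grad f x))\<^sup>2 * \<rho> x)" by (intro continuous_intros C1 c\<rho>)
  define M where "M = (\<lambda>n. integral (cube n) (\<lambda>x. (f x)\<^sup>2 * \<rho> x))"
  define N where "N = (\<lambda>n. integral (cube n) \<rho>)"
  define D where "D = (\<lambda>n. integral (cube n) (\<lambda>x. (norm (grad f x))\<^sup>2 * \<rho> x))"
  define E where "E = (\<lambda>n. integral (cube n) (\<lambda>x. (f x)\<^sup>2 * ln ((f x)\<^sup>2) * \<rho> x))"
  define m where "m = (\<integral>x. (f x)\<^sup>2 * \<rho> x \<partial>lborel)"
  have M: "M \<longlonglongrightarrow> m" unfolding M_def m_def by (rule integral_cube_tendsto[OF if2 cf2])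
  have N: "N \<longlonglongrightarrow> 1" unfolding N_def \<rho>1[symmetric] by (rule integral_cube_tendsto[OF i\<rho> c\<rho>])
  have D: "D \<longlonglongrightarrow> (\<integral>x. (norm (grad f x))\<^sup>2 * \<rho> x \<partial>lborel)"
    unfolding D_def by (rule integral_cube_tendsto[OF ig2 cg2])
  have Npos: "0 < N n" for n unfolding N_def
    by (intro integral_cbox_pos box_centered_cube_nonempty[OF of_nat_0_less_iff[THEN iffD2, OF zero_less_Suc]] \<rho> continuous_on_subset[OF c\<rho>]) simp
  have M0: "0 \<le> M n" for n unfolding M_def using \<rho>
    by (intro integral_nonneg integrable_continuous continuous_on_subset[OF cf2]) (auto simp: less_imp_le)
  have m0: "0 \<le> m" unfolding m_def using \<rho> by (intro Bochner_Integration.integral_nonneg) (simp add: less_imp_le)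
  have "(\<lambda>n. M n / N n) \<longlonglongrightarrow> m" using tendsto_divide[OF M N] by simp
  then have "(\<lambda>n. (M n / N n) * ln (M n / N n)) \<longlonglongrightarrow> m * ln m"
    by (rule continuous_on_tendsto_compose[OF continuous_on_x_ln_x])
       (use m0 M0 Npos in \<open>auto intro!: always_eventually divide_nonneg_pos\<close>)
  from tendsto_mult[OF N this]
  have "(\<lambda>n. N n * ((M n / N n) * ln (M n / N n))) \<longlonglongrightarrow> m * ln m" by simp
  then have Ml: "(\<lambda>n. M n * ln (M n / N n)) \<longlonglongrightarrow> m * ln m"
    using Npos by (simp add: less_imp_neq[symmetric])
  have ent: "E n \<le> 2 * C * D n + M n * ln (M n / N n)" for n
    using lsi[OF f, of n] by (simp add: entropy_on_def E_def D_def M_def N_def)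
  have r: "(\<lambda>n. 2 * C * D n + M n * ln (M n / N n))
      \<longlonglongrightarrow> 2 * C * (\<integral>x. (norm (grad f x))\<^sup>2 * \<rho> x \<partial>lborel) + m * ln m"
    by (intro tendsto_intros D Ml)
  have "integrable lborel (\<lambda>x. (f x)\<^sup>2 * ln ((f x)\<^sup>2) * \<rho> x + \<rho> x)"
  proof (rule integrable_of_bounded_cube_integrals)
    show "continuous_on UNIV (\<lambda>x. (f x)\<^sup>2 * ln ((f x)\<^sup>2) * \<rho> x + \<rho> x)"
      by (intro continuous_on_add cfl c\<rho>)
    show "0 \<le> (f x)\<^sup>2 * ln ((f x)\<^sup>2) * \<rho> x + \<rho> x" for x
    proof -
      have "0 \<le> y * ln y + 1" if y: "0 \<le> y" for y :: real
      proof (cases "y = 0")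
        case False
        then have "ln (1 / y) \<le> 1 / y - 1" using y by (intro ln_le_minus_one) auto
        then have "y * - ln y \<le> y * (1 / y - 1)" using y False by (intro mult_left_mono) (auto simp: ln_div)
        then show ?thesis using y False by (simp add: right_diff_distrib)
      qed simp
      from this[of "(f x)\<^sup>2"] have "0 \<le> ((f x)\<^sup>2 * ln ((f x)\<^sup>2) + 1) * \<rho> x"
        using \<rho>[of x] by (intro mult_nonneg_nonneg) auto
      then show ?thesis by (simp add: algebra_simps)
    qed
    show "integral (cube n) (\<lambda>x. (f x)\<^sup>2 * ln ((f x)\<^sup>2) * \<rho> x + \<rho> x)
        \<le> 2 * C * D n + M n * ln (M n / N n) + N n" for n
    proof -
      have "integral (cube n) (\<lambda>x. (f x)\<^sup>2 * ln ((f x)\<^sup>2) * \<rho> x + \<rho> x) = E n + N n"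
        unfolding E_def N_def
        by (intro integral_add integrable_continuous continuous_on_subset[OF cfl] continuous_on_subset[OF c\<rho>]) auto
      then show ?thesis using ent[of n] by simp
    qed
    show "(\<lambda>n. 2 * C * D n + M n * ln (M n / N n) + N n)
      \<longlonglongrightarrow> 2 * C * (\<integral>x. (norm (grad f x))\<^sup>2 * \<rho> x \<partial>lborel) + m * ln m + 1"
      by (intro tendsto_add r N)
  qed
  from Bochner_Integration.integrable_diff[OF this i\<rho>]
  have intE: "integrable lborel (\<lambda>x. (f x)\<^sup>2 * ln ((f x)\<^sup>2) * \<rho> x)" by simp
  have "E \<longlonglongrightarrow> (\<integral>x. (f x)\<^sup>2 * ln ((f x)\<^sup>2) * \<rho> x \<partial>lborel)"
    unfolding E_def by (rule integral_cube_tendsto[OF intE cfl])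
  then have "(\<integral>x. (f x)\<^sup>2 * ln ((f x)\<^sup>2) * \<rho> x \<partial>lborel)
      \<le> 2 * C * (\<integral>x. (norm (grad f x))\<^sup>2 * \<rho> x \<partial>lborel) + m * ln m"
    using r ent by (intro LIMSEQ_le) auto
  with intE show "integrable lborel (\<lambda>x. (f x)\<^sup>2 * ln ((f x)\<^sup>2) * \<rho> x) \<and>
     (\<integral>x. (f x)\<^sup>2 * ln ((f x)\<^sup>2) * \<rho> x \<partial>lborel)
         - (\<integral>x. (f x)\<^sup>2 * \<rho> x \<partial>lborel) * ln (\<integral>x. (f x)\<^sup>2 * \<rho> x \<partial>lborel)
       \<le> 2 * C * (\<integral>x. (norm (grad f x))\<^sup>2 * \<rho> x \<partial>lborel)"
    by (simp add: m_def)
qed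

lemma poincare_ineq_of_cubes:
  fixes \<rho> :: "'a::euclidean_space \<Rightarrow> real"
  assumes c\<rho>: "continuous_on UNIV \<rho>" and \<rho>: "\<And>x. 0 < \<rho> x" and prob: "prob_density \<rho>"
    and lsi: "\<And>n f. C_class 1 f \<Longrightarrow>
       entropy_on (cube n) \<rho> (\<lambda>x. (f x)\<^sup>2) \<le> 2 * C * integral (cube n) (\<lambda>x. (norm (grad f x))\<^sup>2 * \<rho> x)"
  shows "poincare_ineq \<rho> C"
  unfolding poincare_ineq_def
proof (intro allI impI)
  fix f assume "weighted_C1 \<rho> f"
  then have f: "C_class 1 f" and if2: "integrable lborel (\<lambda>x. (f x)\<^sup>2 * \<rho> x)"
    and ig2: "integrable lborel (\<lambda>x. (norm (grad f x))\<^sup>2 * \<rho> x)"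
    by (auto simp: weighted_C1_def)
  have i\<rho>: "integrable lborel \<rho>" and \<rho>1: "(\<integral>x. \<rho> x \<partial>lborel) = 1"
    using prob by (auto simp: prob_density_def has_bochner_integral_iff)
  note C1 = C_class_1D[OF f]
  have cf1: "continuous_on UNIV (\<lambda>x. f x * \<rho> x)" by (intro continuous_intros C1 c\<rho>)
  have cf2: "continuous_on UNIV (\<lambda>x. (f x)\<^sup>2 * \<rho> x)" by (intro continuous_intros C1 c\<rho>)
  have cg2: "continuous_on UNIV (\<lambda>x. (norm (grad f x))\<^sup>2 * \<rho> x)" by (intro continuous_intros C1 c\<rho>)
  have if1: "integrable lborel (\<lambda>x. f x * \<rho> x)"
  proof (rule Bochner_Integration.integrable_bound[OF Bochner_Integration.integrable_add[OF if2 i\<rho>]])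
    show "(\<lambda>x. f x * \<rho> x) \<in> borel_measurable lborel" using borel_measurable_continuous_onI[OF cf1] by simp
    show "AE x in lborel. norm (f x * \<rho> x) \<le> norm ((f x)\<^sup>2 * \<rho> x + \<rho> x)"
    proof (rule AE_I2)
      fix x
      have "0 \<le> (\<bar>f x\<bar> - 1)\<^sup>2 + \<bar>f x\<bar>" by simp
      then have "\<bar>f x\<bar> \<le> (f x)\<^sup>2 + 1"
        by (simp add: power2_eq_square algebra_simps)
      then have "\<bar>f x\<bar> * \<rho> x \<le> ((f x)\<^sup>2 + 1) * \<rho> x" using \<rho>[of x] by (intro mult_right_mono) auto
      moreover have "0 \<le> (f x)\<^sup>2 * \<rho> x + \<rho> x" using \<rho>[of x] by simp
      ultimately show "norm (f x * \<rho> x) \<le> norm ((f x)\<^sup>2 * \<rho> x + \<rho> x)"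
        using \<rho>[of x] by (simp add: abs_mult distrib_right)
    qed
  qed
  have pn: "integral (cube n) (\<lambda>x. (f x)\<^sup>2 * \<rho> x) - (integral (cube n) (\<lambda>x. f x * \<rho> x))\<^sup>2 / integral (cube n) \<rho>
      \<le> C * integral (cube n) (\<lambda>x. (norm (grad f x))\<^sup>2 * \<rho> x)" for n
    by (rule poincare_of_log_sobolev[OF box_centered_cube_nonempty[OF of_nat_0_less_iff[THEN iffD2, OF zero_less_Suc]] c\<rho> \<rho> f lsi])
  have "(\<lambda>n. integral (cube n) (\<lambda>x. (f x)\<^sup>2 * \<rho> x) - (integral (cube n) (\<lambda>x. f x * \<rho> x))\<^sup>2 / integral (cube n) \<rho>)
     \<longlonglongrightarrow> (\<integral>x. (f x)\<^sup>2 * \<rho> x \<partial>lborel) - (\<integral>x. f x * \<rho> x \<partial>lborel)\<^sup>2 / (\<integral>x. \<rho> x \<partial>lborel)"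
    by (intro tendsto_diff tendsto_divide tendsto_power integral_cube_tendsto if1 if2 i\<rho> cf1 cf2 c\<rho>) (simp add: \<rho>1)
  moreover have "(\<lambda>n. C * integral (cube n) (\<lambda>x. (norm (grad f x))\<^sup>2 * \<rho> x))
     \<longlonglongrightarrow> C * (\<integral>x. (norm (grad f x))\<^sup>2 * \<rho> x \<partial>lborel)"
    by (intro tendsto_mult tendsto_const integral_cube_tendsto ig2 cg2)
  ultimately have "(\<integral>x. (f x)\<^sup>2 * \<rho> x \<partial>lborel) - (\<integral>x. f x * \<rho> x \<partial>lborel)\<^sup>2 / (\<integral>x. \<rho> x \<partial>lborel)
      \<le> C * (\<integral>x. (norm (grad f x))\<^sup>2 * \<rho> x \<partial>lborel)"
    using pn by (intro LIMSEQ_le) auto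
  then show "(\<integral>x. (f x)\<^sup>2 * \<rho> x \<partial>lborel) - (\<integral>x. f x * \<rho> x \<partial>lborel)\<^sup>2
       \<le> C * (\<integral>x. (norm (grad f x))\<^sup>2 * \<rho> x \<partial>lborel)"
    by (simp add: \<rho>1)
qed

section \<open>Comparison of the stationary density with the Gaussian\<close>

text \<open>
  The derivative in \<open>s\<close> of the function compared here is \<open>\<Xi> 0 - \<Xi> (exp (v (m - s)))\<close>, at most
  \<open>L * exp (v m) * exp (- \<kappa> * s)\<close> in absolute value.  That bound is the derivative of \<open>k\<close>, so adding or
  subtracting \<open>k\<close> yields monotone functions, and \<open>k\<close> itself ranges in an interval of length
  \<open>L * exp (v m) / \<kappa>\<close>.  Bounding the increment rather than the supremum avoids a factor 2 in the
  exponent.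
\<close>

lemma log_ratio_oscillation:
  fixes \<Xi> v :: "real \<Rightarrow> real"
  assumes bounds: "\<And>r. 0 \<le> r \<Longrightarrow> \<kappa> \<le> \<Xi> r \<and> \<Xi> r \<le> K"
    and \<kappa>: "0 < \<kappa>" and Lip: "L-lipschitz_on {0..} \<Xi>"
    and v: "\<And>t. (v has_real_derivative \<Xi> (exp (v t))) (at t)"
    and st: "0 \<le> s" "0 \<le> t"
  shows "\<bar>(v (m - s) + \<Xi> 0 * s) - (v (m - t) + \<Xi> 0 * t)\<bar> \<le> L * exp (v m) / \<kappa>"
proof -
  define A where "A = L * exp (v m) / \<kappa>"
  define u where "u = (\<lambda>s. v (m - s) + \<Xi> 0 * s)"
  define k where "k = (\<lambda>s. - A * exp (- \<kappa> * s))"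
  have L: "0 \<le> L" using Lip by (rule lipschitz_on_nonneg)
  have A: "0 \<le> A" using L \<kappa> by (simp add: A_def)
  have dk: "(k has_real_derivative L * exp (v m) * exp (- \<kappa> * y)) (at y)" for y
    unfolding k_def A_def using \<kappa> by (auto intro!: derivative_eq_intros)
  have du: "(u has_real_derivative \<Xi> 0 - \<Xi> (exp (v (m - y)))) (at y)" for y
  proof -
    have "((\<lambda>s. v (m - s)) has_real_derivative \<Xi> (exp (v (m - y))) * (-1)) (at y)"
      by (rule DERIV_chain2[OF v]) (auto intro!: derivative_eq_intros)
    then show ?thesis unfolding u_def by (auto intro!: derivative_eq_intros)
  qed
  have du_bound: "\<bar>\<Xi> 0 - \<Xi> (exp (v (m - y)))\<bar> \<le> L * exp (v m) * exp (- \<kappa> * y)" if y: "0 \<le> y" for y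
  proof -
    have "\<bar>\<Xi> 0 - \<Xi> (exp (v (m - y)))\<bar> \<le> L * exp (v (m - y))"
      using lipschitz_onD[OF Lip, of 0 "exp (v (m - y))"] by (simp add: dist_real_def)
    also have "\<dots> \<le> L * exp (v m + - \<kappa> * y)"
      using derivative_bounds_imp_increment_bounds(1)[of v "\<lambda>t. \<Xi> (exp (v t))" \<kappa> K "m - y" m, OF v] bounds y L
      by (intro mult_left_mono) auto
    finally show ?thesis by (simp only: exp_add mult.assoc)
  qed
  have main: "\<bar>u s - u t\<bar> \<le> A" if "0 \<le> s" "s \<le> t" for s t
  proof -
    have "u s + k s \<le> u t + k t"
    proof (rule DERIV_nonneg_imp_nondecreasing[OF that(2)])
      fix y assume "s \<le> y" "y \<le> t"
      then show "\<exists>D. DERIV (\<lambda>x. u x + k x) y :> D \<and> 0 \<le> D"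
        using DERIV_add[OF du dk, of y] du_bound[of y] that
        by (intro exI[of _ "\<Xi> 0 - \<Xi> (exp (v (m - y))) + L * exp (v m) * exp (- \<kappa> * y)"]) (auto simp: abs_le_iff)
    qed
    moreover have "u t - k t \<le> u s - k s"
    proof (rule DERIV_nonpos_imp_nonincreasing[OF that(2)])
      fix y assume "s \<le> y" "y \<le> t"
      then show "\<exists>D. DERIV (\<lambda>x. u x - k x) y :> D \<and> D \<le> 0"
        using DERIV_diff[OF du dk, of y] du_bound[of y] that
        by (intro exI[of _ "\<Xi> 0 - \<Xi> (exp (v (m - y))) - L * exp (v m) * exp (- \<kappa> * y)"]) (auto simp: abs_le_iff)
    qed
    moreover have "k t \<le> 0" "- A \<le> k s"
    proof -
      show "k t \<le> 0" using A by (simp add: k_def)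
      have "A * exp (- \<kappa> * s) \<le> A * 1" using A \<kappa> that by (intro mult_left_mono) auto
      then show "- A \<le> k s" by (simp add: k_def)
    qed
    ultimately show ?thesis by (simp add: abs_le_iff)
  qed
  have "\<bar>u s - u t\<bar> \<le> A"
    using main[of s t] main[of t s] st by (cases "s \<le> t") (auto simp: abs_minus_commute)
  then show ?thesis by (simp add: u_def A_def)
qed

theorem lemma3:
  fixes \<Xi> :: "real \<Rightarrow> real"
    and p\<^sub>0 \<pi> :: "'a::euclidean_space \<Rightarrow> real"
    and L \<kappa> K c\<^sub>0 b\<^sub>0 :: real
  assumes Xi_Cb: "continuous_on {0..} \<Xi>" "bounded (\<Xi> ` {0..})"
    and Xi_C1: "C1_halfline \<Xi>"
    and Xi_Lip: "L-lipschitz_on {0..} \<Xi>"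
    and Xi_bounds: "\<And>r. 0 \<le> r \<Longrightarrow> \<kappa> \<le> \<Xi> r \<and> \<Xi> r \<le> K"
    and kappa_K: "0 < \<kappa>" "\<kappa> < K" "K / \<kappa> \<le> 2"
    and p0_density: "prob_density p\<^sub>0"
    and p0_Linfty: "\<exists>M. AE x in lborel. \<bar>p\<^sub>0 x\<bar> \<le> M"
    and p0_bound: "\<And>x. p\<^sub>0 x \<le> c\<^sub>0 * exp (- b\<^sub>0 * (norm x)\<^sup>2)"
    and c0_b0: "0 < c\<^sub>0" "\<kappa> / 2 < b\<^sub>0" "\<Xi> 0 < b\<^sub>0"
    and stationary: "stationary_density \<Xi> \<pi>"
    and unique: "\<And>\<rho>. stationary_density \<Xi> \<rho> \<Longrightarrow> AE x in lborel. \<rho> x = \<pi> x"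
    and representative: "continuous_on UNIV \<pi>"
  shows "(\<forall>x. \<pi> 0 * exp (- K * (norm x)\<^sup>2) \<le> \<pi> x \<and> \<pi> x \<le> \<pi> 0 * exp (- \<kappa> * (norm x)\<^sup>2)) \<and>
    (\<exists>C_LSI C_Poin. log_sobolev_ineq \<pi> C_LSI \<and> poincare_ineq \<pi> C_Poin \<and>
       C_Poin \<le> C_LSI \<and> C_LSI \<le> 1 / (2 * \<Xi> 0) * exp (L * \<pi> 0 / \<kappa>))"
proof -
  obtain v where v: "\<And>t. (v has_real_derivative \<Xi> (exp (v t))) (at t)"
    using log_profile_exists[OF Xi_Cb(1) Xi_bounds kappa_K(1)] by metis
  obtain m where m: "stationary_density \<Xi> (\<lambda>x::'a. exp (v (m - (norm x)\<^sup>2)))"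
    using radial_stationary_density[OF Xi_Cb(1) Xi_bounds kappa_K(1) v] by metis
  have cv: "continuous_on UNIV v"
    using v DERIV_isCont by (auto simp: continuous_on_eq_continuous_at)
  have \<pi>_eq: "\<pi> x = exp (v (m - (norm x)\<^sup>2))" for x
  proof (rule AE_lborel_eq_continuous_imp_eq[where f = \<pi> and g = "\<lambda>x. exp (v (m - (norm x)\<^sup>2))"])
    show "AE x in lborel. \<pi> x = exp (v (m - (norm x)\<^sup>2))"
      using unique[OF m] by eventually_elim simp
    show "continuous_on UNIV (\<lambda>x::'a. exp (v (m - (norm x)\<^sup>2)))"
      by (intro continuous_on_exp continuous_on_compose2[OF cv]) (auto intro!: continuous_intros)
  qed (rule representative)
  have \<pi>0: "\<pi> 0 = exp (v m)" by (simp add: \<pi>_eq)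
  have pos: "0 < \<pi> x" for x by (simp add: \<pi>_eq)
  have prob: "prob_density \<pi>" using stationary by (simp add: stationary_density_def)
  have bounds: "\<pi> 0 * exp (- K * (norm x)\<^sup>2) \<le> \<pi> x \<and> \<pi> x \<le> \<pi> 0 * exp (- \<kappa> * (norm x)\<^sup>2)" for x
    using derivative_bounds_imp_increment_bounds[of v "\<lambda>t. \<Xi> (exp (v t))" \<kappa> K "m - (norm x)\<^sup>2" m, OF v] Xi_bounds
    by (simp add: \<pi>_eq exp_add[symmetric])
  define a where "a = \<Xi> 0"
  have a: "0 < a" using Xi_bounds[of 0] kappa_K(1) by (simp add: a_def)
  define A where "A = L * \<pi> 0 / \<kappa>"
  define \<gamma> where "\<gamma> = (\<lambda>x::'a. exp (- a * (norm x)\<^sup>2))"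
  have \<gamma>: "0 < \<gamma> x" for x by (simp add: \<gamma>_def)
  define q where "q = (\<lambda>x. \<pi> x / \<gamma> x)"
  have q: "q x = exp (v (m - (norm x)\<^sup>2) + \<Xi> 0 * (norm x)\<^sup>2)" for x
    by (simp add: q_def \<pi>_eq \<gamma>_def a_def exp_add exp_minus divide_inverse)
  have osc: "q x \<le> exp A * q y" for x y
    using log_ratio_oscillation[OF Xi_bounds kappa_K(1) Xi_Lip v, of "(norm x)\<^sup>2" "(norm y)\<^sup>2" m]
    by (simp add: q exp_add[symmetric] A_def \<pi>0 abs_le_iff)
  have qpos: "0 < q x" for x by (simp add: q)
  \<comment> \<open>The extremal values of the ratio: \<open>c1 \<le> \<pi> / \<gamma> \<le> exp A * c1\<close>.\<close>
  define c1 where "c1 = Inf (range q)"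
  have c1_le: "c1 \<le> q x" for x
    unfolding c1_def using qpos by (intro cInf_lower bdd_belowI[of _ 0]) (auto simp: less_imp_le)
  have c1: "0 < c1"
  proof -
    have "exp (- A) * q 0 \<le> c1"
      unfolding c1_def using osc[of 0] by (intro cInf_greatest) (auto simp: exp_minus field_simps)
    then show ?thesis using qpos[of 0] by (meson exp_gt_zero less_le_trans mult_pos_pos)
  qed
  have le_c2: "q x \<le> exp A * c1" for x
  proof -
    have "exp (- A) * q x \<le> c1"
      unfolding c1_def using osc[of x] by (intro cInf_greatest) (auto simp: exp_minus field_simps)
    then show ?thesis by (simp add: exp_minus field_simps)
  qed
  define C where "C = 1 / (2 * a) * exp A"
  have lsi: "entropy_on (cube n) \<pi> (\<lambda>x. (f x)\<^sup>2) \<le> 2 * C * integral (cube n) (\<lambda>x. (norm (grad f x))\<^sup>2 * \<pi> x)"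
    if "C_class 1 f" for n f
  proof -
    have "entropy_on (cube n) \<pi> (\<lambda>x. (f x)\<^sup>2)
        \<le> 4 * (exp A * c1 / c1 * (1 / (4 * a))) * integral (cube n) (\<lambda>x. (norm (grad f x))\<^sup>2 * \<pi> x)"
    proof (rule log_sobolev_of_squares[OF box_centered_cube_nonempty[OF of_nat_0_less_iff[THEN iffD2, OF zero_less_Suc]] representative pos that])
      fix F :: "'a \<Rightarrow> real" assume F: "C_class 1 F" "\<And>x. 0 < F x"
      note C1 = C_class_1D[OF F(1)]
      have cD: "continuous_on UNIV (\<lambda>x. (norm (grad F x))\<^sup>2 / F x)"
        using F(2) by (auto intro!: continuous_intros C1 simp: less_imp_neq[symmetric])
      have c\<gamma>: "continuous_on UNIV \<gamma>" unfolding \<gamma>_def by (intro continuous_intros)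
      show "entropy_on (cube n) \<pi> F \<le> exp A * c1 / c1 * (1 / (4 * a)) *
          integral (cube n) (\<lambda>x. (norm (grad F x))\<^sup>2 / F x * \<pi> x)"
      proof (rule holley_stroock_perturbation[OF box_centered_cube_nonempty[OF of_nat_0_less_iff[THEN iffD2, OF zero_less_Suc]] _ _ c1 \<gamma>])
        show "c1 * \<gamma> x \<le> \<pi> x" for x using c1_le[of x] \<gamma>[of x] by (simp add: q_def field_simps)
        show "\<pi> x \<le> exp A * c1 * \<gamma> x" for x using le_c2[of x] \<gamma>[of x] by (simp add: q_def field_simps)
        show "entropy_on (cube n) \<gamma> F \<le> 1 / (4 * a) * integral (cube n) (\<lambda>x. (norm (grad F x))\<^sup>2 / F x * \<gamma> x)"
          unfolding \<gamma>_def by (rule gaussian_log_sobolev_cube[OF a F])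
      qed (use F a c\<gamma> cD C1(2) representative in \<open>auto intro: continuous_on_subset simp: less_imp_le\<close>)
    qed (use a c1 in simp)
    then show ?thesis using c1 by (simp add: C_def)
  qed
  have "log_sobolev_ineq \<pi> C"
    by (rule log_sobolev_ineq_of_cubes[OF representative pos prob lsi])
  moreover have "poincare_ineq \<pi> C"
    by (rule poincare_ineq_of_cubes[OF representative pos prob lsi])
  moreover have "C \<le> 1 / (2 * \<Xi> 0) * exp (L * \<pi> 0 / \<kappa>)" by (simp add: C_def A_def a_def)
  ultimately show ?thesis using bounds by blast
qed

end
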